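(* Let $\mathcal{L}\subset\mathbb{R}^N$ be a repetitive Delone set of finite local complexity with dynamical system $(\Omega_{\mathcal{L}},\mathbb{R}^N)$. If the statistical coincidence relation $SC$ on $\Omega_{\mathcal{L}}$ coincides with the equicontinuous structure relation $R_{max}$, then all of the following relations on $\Omega_{\mathcal{L}}$ agree with $SC$: the equicontinuous structure relation, the proximality relation, the regional proximality relation, the syndetic proximality relation, the strong proximality relation, the strong regional proximality relation and the strong syndetic proximality relation; and the coincidence rank is $cr=1$.
   Context: Delone set: uniformly discrete and relatively dense subset of $\mathbb{R}^N$. Finite local complexity (FLC): $\{(\mathcal{L}-x)\cap K:x\in\mathcal{L}\}$ is finite for every compact $K$; sets $(\mathcal{L}-x)\cap K$, $x\in\mathcal L$, are patches. Repetitive: the set of occurrences of each nonempty patch is relatively dense. The hull $\Omega_{\mathcal{L}}$ is the set of all Delone sets all of whose patches are patches of $\mathcal{L}$, with $\mathbb{R}^N$ acting by $t\cdot\mathcal{L}'=\mathcal{L}'-t$ and compact metric $d(\mathcal{L}_1,\mathcal{L}_2)=\inf\{\frac{\epsilon}{\epsilon+1}:\exists t,t'\in B_\epsilon(0),\ B_{1/\epsilon}[\mathcal{L}_1-t]=B_{1/\epsilon}[\mathcal{L}_2-t']\}$, where $B_R[\mathcal{L}]=\mathcal{L}\cap B_R(0)$ (closed ball). The system is minimal. Its maximal equicontinuous factor $(\Omega_{max},\mathbb{R}^N)$ is the unique (up to conjugacy) equicontinuous factor of which every equicontinuous factor is a factor; $\pi_{max}$ is the factor map. Relations on $\Omega=\Omega_{\mathcal{L}}$: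 - equicontinuous structure relation $R_{max}=\{(x,y):\pi_{max}(x)=\pi_{max}(y)\}$; - proximality $P=\bigcap_{\epsilon>0}P_\epsilon$, $P_\epsilon=\{(x,y):\exists t,\ d(t\cdot x,t\cdot y)<\epsilon\}$; - regional proximality $Q=\bigcap_{\epsilon>0}\overline{P_\epsilon}$; - syndetic proximality: for all $\epsilon>0$ the set $\{t:d(t\cdot x,t\cdot y)<\epsilon\}$ is relatively dense; - strong proximality: for all $R$ there is $t$ with $B_R[\mathcal{L}_1-t]=B_R[\mathcal{L}_2-t]$; - strong regional proximality: for all $R$ there are $\mathcal{L}_1',\mathcal{L}_2'\in\Omega$, $t\in\mathbb{R}^N$ with $B_R[\mathcal{L}_i]=B_R[\mathcal{L}_i']$ ($i=1,2$) and $B_R[\mathcal{L}_1'-t]=B_R[\mathcal{L}_2'-t]$; - strong syndetic proximality: for all $R$ the set of $t$ with $B_R[\mathcal{L}_1-t]=B_R[\mathcal{L}_2-t]$ is relatively dense; - statistical coincidence $SC$: the upper density of $\mathcal{L}_1\bigtriangleup\mathcal{L}_2$ is $0$, where, for a fixed van Hove sequence $(\Lambda_n)_n$, the upper density of $\mathcal{D}$ is $\limsup_n\#(\mathcal{D}\cap\Lambda_n)/vol(\Lambda_n)$. A van Hove sequence is a sequence of compact sets with non-empty interior exhausting $\mathbb{R}^N$ with $|\partial^K\Lambda_n|/|\Lambda_n|\to0$ for every compact $K$, where $\partial^K\Sigma=\overline{(\Sigma+K)\setminus\Sigma}\cup((\overline{\mathbb{R}^N\setminus\Sigma}-K)\cap\Sigma)$.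 Coincidence rank: $cr=\sup\{l:\exists x_1,\dots,x_l\in\pi_{max}^{-1}(\xi),\ (x_i,x_j)\notin P\text{ for }i\ne j\}$, independent of $\xi\in\Omega_{max}$. *)

theory Defs
  imports "HOL-Analysis.Analysis"
begin

section \<open>Delone sets and the hull\<close>

definition relatively_dense :: "'a::euclidean_space set \<Rightarrow> bool" where
  "relatively_dense S \<longleftrightarrow> (\<exists>R. \<forall>x. \<exists>y\<in>S. dist x y \<le> R)"

definition delone :: "'a::euclidean_space set \<Rightarrow> bool" where
  "delone S \<longleftrightarrow> uniform_discrete S \<and> relatively_dense S"

definition translate :: "'a::euclidean_space \<Rightarrow> 'a set \<Rightarrow> 'a set" where
  "translate t S = (\<lambda>x. x - t) ` S"

text \<open>Patches are taken relative to their window \<open>K\<close>: a \<open>K\<close>-patch of one set is compared only with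
  the \<open>K\<close>-patches of another. Forgetting \<open>K\<close> would make every finite subset of \<open>S\<close> a patch
  (up to translation), and the hull would then contain sets with points removed.\<close>

definition patches :: "'a::euclidean_space set \<Rightarrow> 'a set \<Rightarrow> 'a set set" where
  "patches S K = {translate x S \<inter> K | x. x \<in> S}"

definition finite_local_complexity :: "'a::euclidean_space set \<Rightarrow> bool" where
  "finite_local_complexity S \<longleftrightarrow> (\<forall>K. compact K \<longrightarrow> finite (patches S K))"

definition repetitive :: "'a::euclidean_space set \<Rightarrow> bool" where
  "repetitive S \<longleftrightarrow>
     (\<forall>K. compact K \<longrightarrow> (\<forall>p\<in>patches S K. p \<noteq> {} \<longrightarrow>
        relatively_dense {x \<in> S. translate x S \<inter> K = p}))"

definition delone_hull :: "'a::euclidean_space set \<Rightarrow> 'a set set" where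
  "delone_hull S = {S'. delone S' \<and> (\<forall>K. compact K \<longrightarrow> patches S' K \<subseteq> patches S K)}"

definition central_patch :: "real \<Rightarrow> 'a::euclidean_space set \<Rightarrow> 'a set" where
  "central_patch R S = S \<inter> cball 0 R"

text \<open>The element \<open>1\<close> only serves to give a value on pairs of arbitrary sets for which no \<open>\<epsilon>\<close> is
  admissible. It does not affect the distance of two Delone sets: all the other elements are
  below \<open>1\<close>, and some large \<open>\<epsilon>\<close> is always admissible for them.\<close>

definition delone_dist :: "'a::euclidean_space set \<Rightarrow> 'a set \<Rightarrow> real" where
  "delone_dist A B =
     Inf (insert 1 {\<epsilon> / (\<epsilon> + 1) | \<epsilon>. \<epsilon> > 0 \<and>
       (\<exists>t\<in>cball 0 \<epsilon>. \<exists>t'\<in>cball 0 \<epsilon>.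
          central_patch (1 / \<epsilon>) (translate t A) = central_patch (1 / \<epsilon>) (translate t' B))})"

lemma delone_dist_le:
  assumes "e > 0" "norm t \<le> e" "norm t' \<le> e"
    and "central_patch (1 / e) (translate t A) = central_patch (1 / e) (translate t' B)"
  shows "delone_dist A B \<le> e / (e + 1)"
  unfolding delone_dist_def
proof (rule cInf_lower)
  show "bdd_below (insert 1 {\<epsilon> / (\<epsilon> + 1) |\<epsilon>. \<epsilon> > 0 \<and>
       (\<exists>t\<in>cball 0 \<epsilon>. \<exists>t'\<in>cball 0 \<epsilon>.
          central_patch (1 / \<epsilon>) (translate t A) = central_patch (1 / \<epsilon>) (translate t' B))})"
    by (rule bdd_belowI[of _ 0]) auto
  have "t \<in> cball 0 e" "t' \<in> cball 0 e"
    using assms by auto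
  then show "e / (e + 1) \<in> insert 1 {\<epsilon> / (\<epsilon> + 1) |\<epsilon>. \<epsilon> > 0 \<and>
       (\<exists>t\<in>cball 0 \<epsilon>. \<exists>t'\<in>cball 0 \<epsilon>.
          central_patch (1 / \<epsilon>) (translate t A) = central_patch (1 / \<epsilon>) (translate t' B))}"
    using assms by blast
qed

lemma delone_dist_le_1: "delone_dist A B \<le> 1"
  unfolding delone_dist_def
  by (rule cInf_lower) (auto intro!: bdd_belowI[of _ 0])

lemma delone_dist_nonneg: "0 \<le> delone_dist A B"
  unfolding delone_dist_def by (rule cInf_greatest) auto

lemma delone_dist_commute: "delone_dist A B = delone_dist B A"
  unfolding delone_dist_def by (rule arg_cong[where f = Inf]) force

lemma delone_dist_witness:
  assumes "delone_dist A B < r" "r \<le> 1"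
  obtains e t t' where "e > 0" "e / (e + 1) < r" "norm t \<le> e" "norm t' \<le> e"
    "central_patch (1 / e) (translate t A) = central_patch (1 / e) (translate t' B)"
proof -
  obtain y where "y < r" "y \<in> insert 1 {\<epsilon> / (\<epsilon> + 1) |\<epsilon>. \<epsilon> > 0 \<and>
       (\<exists>t\<in>cball 0 \<epsilon>. \<exists>t'\<in>cball 0 \<epsilon>.
          central_patch (1 / \<epsilon>) (translate t A) = central_patch (1 / \<epsilon>) (translate t' B))}"
    using assms(1) unfolding delone_dist_def by (metis (lifting) cInf_lessD insert_not_empty)
  then show thesis
    using assms(2) that by auto
qed

lemma mem_central_patch_translate:
  "v \<in> central_patch R (translate t A) \<longleftrightarrow> v + t \<in> A \<and> norm v \<le> R"
  unfolding central_patch_def translate_def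
  by (auto simp: image_iff algebra_simps)

lemma delone_dist_eq_0_imp_subset:
  assumes "closed B" "delone_dist A B = 0"
  shows "A \<subseteq> B"
proof
  fix x assume x: "x \<in> A"
  have "\<exists>y\<in>B. dist y x < \<delta>" if "\<delta> > 0" for \<delta> :: real
  proof -
    define m where "m = min (\<delta> / 3) (1 / (norm x + 1))"
    have m: "m > 0" "m \<le> \<delta> / 3" "m \<le> 1 / (norm x + 1)"
      using that by (auto simp: m_def add_nonneg_pos)
    have m1: "m \<le> 1"
      using m(3) by (rule order.trans) (smt (verit) divide_le_eq_1_pos norm_ge_zero)
    define r where "r = m / (m + 1)"
    have r: "r > 0" "r \<le> 1" using m by (auto simp: r_def)
    obtain e t t' where e: "e > 0" "e / (e + 1) < r" "norm t \<le> e" "norm t' \<le> e"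
      "central_patch (1 / e) (translate t A) = central_patch (1 / e) (translate t' B)"
      using delone_dist_witness[of A B r] assms(2) r by auto
    have em: "e < m"
      using e(1,2) m(1) by (simp add: r_def divide_simps algebra_simps)
    have "0 < norm x + 1"
      by (simp add: add_nonneg_pos)
    then have "norm x + 1 \<le> 1 / m"
      using m(1,3) by (metis le_divide_eq mult.commute less_le_not_le)
    also have "\<dots> < 1 / e"
      using em e(1) m(1) by (simp add: frac_less2)
    finally have "norm x + 1 < 1 / e" .
    moreover have "norm (x - t) \<le> norm x + e"
      using norm_triangle_ineq4[of x t] e(3) by linarith
    ultimately have "norm (x - t) \<le> 1 / e"
      using em m1 by linarith
    then have "x - t \<in> central_patch (1 / e) (translate t A)"
      using x by (simp add: mem_central_patch_translate)
    then have "x - t + t' \<in> B"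
      using e(5) by (simp add: mem_central_patch_translate)
    moreover have "dist (x - t + t') x < \<delta>"
    proof -
      have "dist (x - t + t') x = norm (t' - t)" by (simp add: dist_norm)
      also have "\<dots> \<le> 2 * e"
        using norm_triangle_ineq4[of t' t] e(3,4) by linarith
      finally show ?thesis using em m e(1) that by linarith
    qed
    ultimately show ?thesis by blast
  qed
  then have "x \<in> closure B"
    by (simp add: closure_approachable)
  then show "x \<in> B"
    using assms(1) by simp
qed

lemma delone_dist_triangle: "delone_dist A C \<le> delone_dist A B + delone_dist B C"
proof (rule ccontr)
  assume "\<not> ?thesis"
  then have lt: "delone_dist A B + delone_dist B C < delone_dist A C" by simp
  define \<eta> where "\<eta> = (delone_dist A C - delone_dist A B - delone_dist B C) / 2"
  have eta: "\<eta> > 0" using lt by (simp add: \<eta>_def)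
  have le1: "delone_dist A C \<le> 1" by (rule delone_dist_le_1)
  have nn: "0 \<le> delone_dist A B" "0 \<le> delone_dist B C"
    by (rule delone_dist_nonneg)+
  have sum: "(delone_dist A B + \<eta>) + (delone_dist B C + \<eta>) = delone_dist A C"
    by (simp add: \<eta>_def field_simps)
  obtain e1 t t' where 1: "e1 > 0" "e1 / (e1 + 1) < delone_dist A B + \<eta>" "norm t \<le> e1" "norm t' \<le> e1"
      "central_patch (1 / e1) (translate t A) = central_patch (1 / e1) (translate t' B)"
    using delone_dist_witness[of A B "delone_dist A B + \<eta>"] eta nn sum le1 by auto
  obtain e2 s s' where 2: "e2 > 0" "e2 / (e2 + 1) < delone_dist B C + \<eta>" "norm s \<le> e2" "norm s' \<le> e2"
      "central_patch (1 / e2) (translate s B) = central_patch (1 / e2) (translate s' C)"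
    using delone_dist_witness[of B C "delone_dist B C + \<eta>"] eta nn sum le1 by auto
  have slt: "e1 / (e1 + 1) + e2 / (e2 + 1) < delone_dist A C"
    using 1(2) 2(2) sum by linarith
  then have "e1 / (e1 + 1) + e2 / (e2 + 1) < 1"
    using le1 by linarith
  then have prod: "e1 * e2 < 1"
    using 1(1) 2(1) by (simp add: divide_simps) (simp add: algebra_simps)
  define e3 where "e3 = (e1 + e2 + 2 * (e1 * e2)) / (1 - e1 * e2)"
  have pos12: "e1 * e2 > 0" using 1(1) 2(1) by simp
  have num: "e1 + e2 + 2 * (e1 * e2) > 0" using pos12 1(1) 2(1) by linarith
  have e3pos: "e3 > 0" using num prod by (simp add: e3_def)
  have e3sum: "e1 + e2 \<le> e3"
  proof -
    have "(e1 + e2) * (1 - e1 * e2) \<le> (e1 + e2) * 1"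
      using pos12 1(1) 2(1) by (intro mult_left_mono) auto
    also have "\<dots> \<le> e1 + e2 + 2 * (e1 * e2)" using pos12 by simp
    finally show ?thesis using prod by (simp add: e3_def pos_le_divide_eq)
  qed
  have inv: "1 / e3 = (1 - e1 * e2) / (e1 + e2 + 2 * (e1 * e2))"
    by (simp add: e3_def)
  have r1: "1 / e3 + e2 \<le> 1 / e1"
  proof -
    have "1 / e3 \<le> (1 - e1 * e2) / e1"
      unfolding inv using prod pos12 num 1(1) 2(1) by (intro divide_left_mono mult_pos_pos) auto
    then show ?thesis using 1(1) by (simp add: field_simps)
  qed
  have r2: "1 / e3 + e1 \<le> 1 / e2"
  proof -
    have "1 / e3 \<le> (1 - e1 * e2) / e2"
      unfolding inv using prod pos12 num 1(1) 2(1) by (intro divide_left_mono mult_pos_pos) auto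
    then show ?thesis using 2(1) by (simp add: field_simps)
  qed
  have eq3: "e3 / (e3 + 1) = e1 / (e1 + 1) + e2 / (e2 + 1)"
  proof -
    have ne: "e1 + 1 \<noteq> 0" "e2 + 1 \<noteq> 0" "1 - e1 * e2 \<noteq> 0" using 1(1) 2(1) prod by auto
    have "e3 + 1 = ((e1 + 1) * (e2 + 1)) / (1 - e1 * e2)"
      using ne by (simp add: e3_def field_simps)
    then have "e3 / (e3 + 1) = (e1 + e2 + 2 * (e1 * e2)) / ((e1 + 1) * (e2 + 1))"
      using ne by (simp add: e3_def)
    also have "\<dots> = e1 / (e1 + 1) + e2 / (e2 + 1)"
      using ne by (simp add: field_simps)
    finally show ?thesis .
  qed
  have "central_patch (1 / e3) (translate (t + s) A) = central_patch (1 / e3) (translate (t' + s') C)"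
  proof (rule set_eqI)
    fix v
    show "v \<in> central_patch (1 / e3) (translate (t + s) A) \<longleftrightarrow>
          v \<in> central_patch (1 / e3) (translate (t' + s') C)"
    proof (cases "norm v \<le> 1 / e3")
      case True
      have "norm (v + s) \<le> 1 / e1"
        using norm_triangle_ineq[of v s] True 2(3) r1 by linarith
      then have a: "v + s + t \<in> A \<longleftrightarrow> v + s + t' \<in> B"
        using 1(5) by (metis mem_central_patch_translate)
      have "norm (v + t') \<le> 1 / e2"
        using norm_triangle_ineq[of v t'] True 1(4) r2 by linarith
      then have "v + t' + s \<in> B \<longleftrightarrow> v + t' + s' \<in> C"
        using 2(5) by (metis mem_central_patch_translate)
      with a show ?thesis
        by (simp add: mem_central_patch_translate add_ac)
    qed (simp add: mem_central_patch_translate)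
  qed
  moreover have "norm (t + s) \<le> e3" "norm (t' + s') \<le> e3"
    using norm_triangle_ineq[of t s] norm_triangle_ineq[of t' s'] 1(3,4) 2(3,4) e3sum by linarith+
  ultimately have "delone_dist A C \<le> e3 / (e3 + 1)"
    using e3pos by (intro delone_dist_le)
  then show False using eq3 slt by linarith
qed

lemma Metric_space_delone_hull: "Metric_space (delone_hull S) delone_dist"
proof
  fix A B :: "'a set"
  assume "A \<in> delone_hull S" "B \<in> delone_hull S"
  then have cl: "closed A" "closed B"
    by (auto simp: delone_hull_def delone_def uniform_discrete_imp_closed)
  have "delone_dist A A \<le> 0"
  proof (rule field_le_epsilon)
    fix e :: real assume "e > 0"
    have "delone_dist A A \<le> e / (e + 1)"
      by (rule delone_dist_le[of _ 0 0]) (use \<open>e > 0\<close> in auto)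
    also have "\<dots> \<le> 0 + e" using \<open>e > 0\<close> by (simp add: field_simps)
    finally show "delone_dist A A \<le> 0 + e" .
  qed
  then have "delone_dist A A = 0"
    using delone_dist_nonneg[of A A] by linarith
  then show "delone_dist A B = 0 \<longleftrightarrow> A = B"
    using delone_dist_eq_0_imp_subset[of A B] delone_dist_eq_0_imp_subset[of B A] cl
    by (auto simp: delone_dist_commute[of B A])
qed (rule delone_dist_nonneg delone_dist_commute delone_dist_triangle)+

definition hull_topology :: "'a::euclidean_space set \<Rightarrow> 'a set topology" where
  "hull_topology S = Metric_space.mtopology (delone_hull S) delone_dist"


section \<open>Equicontinuous factors\<close>

definition dynamical_system ::
    "'x topology \<Rightarrow> ('a::euclidean_space \<Rightarrow> 'x \<Rightarrow> 'x) \<Rightarrow> bool" where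
  "dynamical_system X \<alpha> \<longleftrightarrow>
     compact_space X \<and> Hausdorff_space X \<and>
     continuous_map (prod_topology euclidean X) X (\<lambda>(t, x). \<alpha> t x) \<and>
     (\<forall>x\<in>topspace X. \<alpha> 0 x = x) \<and>
     (\<forall>s t. \<forall>x\<in>topspace X. \<alpha> (s + t) x = \<alpha> s (\<alpha> t x))"

text \<open>On a compact space the choice of the compatible metric is irrelevant. Hausdorff factors of
  compact metric systems are metrizable, so no factor is lost by asking for a metric.\<close>

definition equicontinuous_system ::
    "'x topology \<Rightarrow> ('a::euclidean_space \<Rightarrow> 'x \<Rightarrow> 'x) \<Rightarrow> bool" where
  "equicontinuous_system X \<alpha> \<longleftrightarrow> dynamical_system X \<alpha> \<and>
     (\<exists>d. Metric_space (topspace X) d \<and> Metric_space.mtopology (topspace X) d = X \<and>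
        (\<forall>\<epsilon>>0. \<exists>\<delta>>0. \<forall>x\<in>topspace X. \<forall>y\<in>topspace X.
           d x y < \<delta> \<longrightarrow> (\<forall>t. d (\<alpha> t x) (\<alpha> t y) < \<epsilon>)))"

definition factor_map ::
    "'x topology \<Rightarrow> ('a::euclidean_space \<Rightarrow> 'x \<Rightarrow> 'x) \<Rightarrow>
     'y topology \<Rightarrow> ('a \<Rightarrow> 'y \<Rightarrow> 'y) \<Rightarrow> ('x \<Rightarrow> 'y) \<Rightarrow> bool" where
  "factor_map X \<alpha> Y \<beta> f \<longleftrightarrow>
     continuous_map X Y f \<and> f ` topspace X = topspace Y \<and>
     (\<forall>t. \<forall>x\<in>topspace X. f (\<alpha> t x) = \<beta> t (f x))"

text \<open>The competing equicontinuous factors \<open>Z\<close> are taken on the type \<open>'x set\<close>. This is no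
  restriction: every factor of \<open>X\<close> is conjugate to one whose points are the fibres of its
  factor map, which are sets of points of \<open>X\<close>. Compatibility of \<open>\<sigma>\<close> with \<open>\<pi>\<close> and \<open>\<rho>\<close> is not required: for
  minimal \<open>X\<close>, the case at hand, it can be arranged, since endomorphisms of minimal
  equicontinuous \<open>\<real>\<^sup>N\<close>-systems are automorphisms.\<close>

definition maximal_equicontinuous_factor ::
    "'x topology \<Rightarrow> ('a::euclidean_space \<Rightarrow> 'x \<Rightarrow> 'x) \<Rightarrow>
     'y topology \<Rightarrow> ('a \<Rightarrow> 'y \<Rightarrow> 'y) \<Rightarrow> ('x \<Rightarrow> 'y) \<Rightarrow> bool" where
  "maximal_equicontinuous_factor X \<alpha> Y \<beta> \<pi> \<longleftrightarrow>
     equicontinuous_system Y \<beta> \<and> factor_map X \<alpha> Y \<beta> \<pi> \<and>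
     (\<forall>(Z :: 'x set topology) \<gamma> \<rho>.
        equicontinuous_system Z \<gamma> \<and> factor_map X \<alpha> Z \<gamma> \<rho> \<longrightarrow>
        (\<exists>\<sigma>. factor_map Y \<beta> Z \<gamma> \<sigma>))"


section \<open>Relations on the hull\<close>

definition equicontinuous_structure_rel ::
    "'a::euclidean_space set \<Rightarrow> ('a set \<Rightarrow> 'y) \<Rightarrow> ('a set \<times> 'a set) set" where
  "equicontinuous_structure_rel S \<pi> = {(x, y) \<in> delone_hull S \<times> delone_hull S. \<pi> x = \<pi> y}"

definition proximal_eps ::
    "'a::euclidean_space set \<Rightarrow> real \<Rightarrow> ('a set \<times> 'a set) set" where
  "proximal_eps S \<epsilon> =
     {(x, y) \<in> delone_hull S \<times> delone_hull S. \<exists>t. delone_dist (translate t x) (translate t y) < \<epsilon>}"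

definition proximal_rel :: "'a::euclidean_space set \<Rightarrow> ('a set \<times> 'a set) set" where
  "proximal_rel S = (\<Inter>\<epsilon>\<in>{0<..}. proximal_eps S \<epsilon>)"

definition regional_proximal_rel :: "'a::euclidean_space set \<Rightarrow> ('a set \<times> 'a set) set" where
  "regional_proximal_rel S =
     (\<Inter>\<epsilon>\<in>{0<..}. prod_topology (hull_topology S) (hull_topology S) closure_of proximal_eps S \<epsilon>)"

definition syndetic_proximal_rel :: "'a::euclidean_space set \<Rightarrow> ('a set \<times> 'a set) set" where
  "syndetic_proximal_rel S =
     {(x, y) \<in> delone_hull S \<times> delone_hull S.
        \<forall>\<epsilon>>0. relatively_dense {t. delone_dist (translate t x) (translate t y) < \<epsilon>}}"

definition strong_proximal_rel :: "'a::euclidean_space set \<Rightarrow> ('a set \<times> 'a set) set" where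
  "strong_proximal_rel S =
     {(x, y) \<in> delone_hull S \<times> delone_hull S.
        \<forall>R>0. \<exists>t. central_patch R (translate t x) = central_patch R (translate t y)}"

definition strong_regional_proximal_rel ::
    "'a::euclidean_space set \<Rightarrow> ('a set \<times> 'a set) set" where
  "strong_regional_proximal_rel S =
     {(x, y) \<in> delone_hull S \<times> delone_hull S.
        \<forall>R>0. \<exists>x'\<in>delone_hull S. \<exists>y'\<in>delone_hull S. \<exists>t.
          central_patch R x = central_patch R x' \<and>
          central_patch R y = central_patch R y' \<and>
          central_patch R (translate t x') = central_patch R (translate t y')}"

definition strong_syndetic_proximal_rel ::
    "'a::euclidean_space set \<Rightarrow> ('a set \<times> 'a set) set" where
  "strong_syndetic_proximal_rel S =
     {(x, y) \<in> delone_hull S \<times> delone_hull S.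
        \<forall>R>0. relatively_dense
          {t. central_patch R (translate t x) = central_patch R (translate t y)}}"


section \<open>Statistical coincidence\<close>

definition vh_boundary :: "'a::euclidean_space set \<Rightarrow> 'a set \<Rightarrow> 'a set" where
  "vh_boundary K A =
     closure ({a + k | a k. a \<in> A \<and> k \<in> K} - A) \<union>
     ({b - k | b k. b \<in> closure (- A) \<and> k \<in> K} \<inter> A)"

definition van_hove :: "(nat \<Rightarrow> 'a::euclidean_space set) \<Rightarrow> bool" where
  "van_hove \<Lambda> \<longleftrightarrow>
     (\<forall>n. compact (\<Lambda> n) \<and> interior (\<Lambda> n) \<noteq> {}) \<and> (\<Union>n. \<Lambda> n) = UNIV \<and>
     (\<forall>K. compact K \<longrightarrow>
        (\<lambda>n. measure lebesgue (vh_boundary K (\<Lambda> n)) / measure lebesgue (\<Lambda> n)) \<longlonglongrightarrow> 0)"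

definition upper_density :: "(nat \<Rightarrow> 'a::euclidean_space set) \<Rightarrow> 'a set \<Rightarrow> ereal" where
  "upper_density \<Lambda> D = limsup (\<lambda>n. ereal (real (card (D \<inter> \<Lambda> n)) / measure lebesgue (\<Lambda> n)))"

definition statistical_coincidence_rel ::
    "(nat \<Rightarrow> 'a::euclidean_space set) \<Rightarrow> 'a set \<Rightarrow> ('a set \<times> 'a set) set" where
  "statistical_coincidence_rel \<Lambda> S =
     {(x, y) \<in> delone_hull S \<times> delone_hull S. upper_density \<Lambda> ((x - y) \<union> (y - x)) = 0}"


section \<open>Coincidence rank\<close>

definition coincidence_rank ::
    "'a::euclidean_space set \<Rightarrow> ('a set \<Rightarrow> 'y) \<Rightarrow> 'y \<Rightarrow> enat" where
  "coincidence_rank S \<pi> \<xi> =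
     Sup {enat l | l. \<exists>x :: nat \<Rightarrow> 'a set.
        (\<forall>i<l. x i \<in> delone_hull S \<and> \<pi> (x i) = \<xi>) \<and>
        (\<forall>i<l. \<forall>j<l. i \<noteq> j \<longrightarrow> (x i, x j) \<notin> proximal_rel S)}"

end

theory Submission
  imports Defs "HOL-Library.Diagonal_Subsequence"
begin

text \<open>
  The relations form a chain. Strong syndetic proximality implies the strong and the syndetic
  versions of proximality, each of these implies regional proximality, possibly via strong regional
  proximality, and regional proximality is contained in the equicontinuous structure
  relation \<open>E\<close>, because the factor map is uniformly continuous and the action on the factor is
  equicontinuous. So all of them agree as soon as \<open>E\<close> is contained in strong syndetic proximality, and then
  two points in one fibre are proximal, so that the coincidence rank is \<open>1\<close>.

  If \<open>E\<close> is statistical coincidence, then each pair in \<open>E\<close> is strongly proximal, since a relatively dense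
  difference would have positive density. To make this syndetic, suppose that a pair in \<open>E\<close> has
  arbitrarily large balls without agreement on \<open>R\<close>-patches. The pairs seen from the centres of these balls
  have a limit in \<open>E\<close>, which does show an agreement. But convergence in the hull is up to small
  translations, so before the limit there is only an agreement after shifting one of the
  sets by some small \<open>s\<close>. The crucial fact is therefore that \<open>q \<in> x\<close> and \<open>q + s \<in> y\<close> with
  \<open>(x, y) \<in> E\<close> and small \<open>s\<close> force \<open>s = 0\<close> (\<open>small_shift_is_zero\<close>).

  Its proof is a geometric argument about the sets \<open>T = x \<inter> (y - s)\<close>. First let \<open>s = 0\<close>. If \<open>T\<close> misses an
  open half-space with inner normal \<open>w\<close>, then \<open>x - y\<close> is relatively dense there, so the half-space
  takes up a vanishing proportion of the van Hove sets \<open>\<Lambda>\<^sub>n\<close>. Finitely many such half-spaces therefore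
  cannot cover the space, which means that \<open>0\<close> is not in the convex hull of the
  compact set of directions \<open>w\<close> that occur. Consequently there is a vector \<open>a\<close> with \<open>a \<bullet> w\<close> positive and bounded
  away from zero for all of them. By compactness, this remains true for \<open>T\<close> with small
  \<open>s\<close> when half-spaces are replaced by large balls touching \<open>T\<close> (\<open>contact_directions\<close>). A ball that is disjoint from \<open>T\<close>
  and is moved in roughly the direction of \<open>a\<close> can then never hit \<open>T\<close>, for at the first contact the
  direction from the contact to the centre does not point forward. Hence, behind each point
  of \<open>T\<close>, there is a cone in which \<open>T\<close> is relatively dense (\<open>coincidences_dense_in_cone\<close>). The cone contains arbitrarily large
  balls, so a limit yields a pair in \<open>E\<close> for which \<open>T\<close>, with the same \<open>s\<close>, is relatively dense
  everywhere. If \<open>s\<close> is nonzero and below the minimal distance of points, then \<open>T + s\<close> lies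
  in \<open>y - x\<close>, against zero density.

  The sets \<open>\<Lambda>\<^sub>n\<close> may drift off in one direction. This is why a half-space without common points does not
  contradict zero density by itself, and why the detour through the cone is made.
\<close>

section \<open>Translations and local agreement\<close>

lemma mem_translate [simp]: "v \<in> translate t A \<longleftrightarrow> v + t \<in> A"
  unfolding translate_def by (auto simp: image_iff algebra_simps)

lemma translate_translate [simp]: "translate s (translate t A) = translate (s + t) A"
  by (rule set_eqI) (simp add: add_ac)

lemma translate_0 [simp]: "translate 0 A = A"
  by (rule set_eqI) simp

lemma mem_central_patch [simp]: "v \<in> central_patch R A \<longleftrightarrow> v \<in> A \<and> norm v \<le> R"
  by (auto simp: central_patch_def)

text \<open>Convergence for \<open>delone_dist\<close> allows small translations, which blur whether two sets have
  a point in common. Eventual equality on every ball does not, and for sets of the hull that are moved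
  so as to contain the origin, finite local complexity makes it available.\<close>

definition locally_tends :: "(nat \<Rightarrow> 'a::euclidean_space set) \<Rightarrow> 'a set \<Rightarrow> bool" where
  "locally_tends X A \<longleftrightarrow> (\<forall>R. \<forall>\<^sub>F n in sequentially. central_patch R (X n) = central_patch R A)"

lemma locally_tendsD:
  assumes "locally_tends X A"
  shows "\<forall>\<^sub>F n in sequentially. \<forall>v. norm v \<le> R \<longrightarrow> (v \<in> X n \<longleftrightarrow> v \<in> A)"
  using assms[unfolded locally_tends_def, rule_format, of R]
  by eventually_elim (metis mem_central_patch)

lemma locally_tends_subseq:
  assumes "locally_tends X A" "strict_mono r"
  shows "locally_tends (X \<circ> r) A"
  using assms(1) eventually_subseq[OF assms(2)] unfolding locally_tends_def o_def by blast

lemma locally_tends_imp_delone_dist_tendsto_0: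
  assumes "locally_tends X A" "a \<longlonglongrightarrow> b"
  shows "(\<lambda>n. delone_dist (translate (a n) (X n)) (translate b A)) \<longlonglongrightarrow> 0"
proof (rule tendstoI)
  fix e :: real assume e: "e > 0"
  have "\<forall>\<^sub>F n in sequentially. dist (a n) b < e"
    using assms(2) e by (rule tendstoD)
  with locally_tendsD[OF assms(1), of "norm b + 1 / e"]
  show "\<forall>\<^sub>F n in sequentially. dist (delone_dist (translate (a n) (X n)) (translate b A)) 0 < e"
  proof eventually_elim
    case (elim n)
    have "v + b \<in> X n \<longleftrightarrow> v + b \<in> A" if "norm v \<le> 1 / e" for v
      using elim(1) that norm_triangle_ineq[of v b] by auto
    then have "central_patch (1 / e) (translate (b - a n) (translate (a n) (X n))) =
        central_patch (1 / e) (translate 0 (translate b A))"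
      by (intro set_eqI) auto
    moreover have "norm (b - a n) \<le> e"
      using elim(2) by (simp add: dist_norm norm_minus_commute)
    ultimately have "delone_dist (translate (a n) (X n)) (translate b A) \<le> e / (e + 1)"
      using e by (intro delone_dist_le[of e "b - a n" 0]) auto
    also have "\<dots> < e" using e by (simp add: field_simps)
    finally show ?case by (simp add: delone_dist_nonneg)
  qed
qed


section \<open>Compactness of the hull\<close>

lemma patches_translate [simp]: "patches (translate t A) K = patches A K"
proof -
  have "x \<in> translate t A \<longleftrightarrow> x + t \<in> A" for x by simp
  moreover have "translate (y - t) (translate t A) = translate y A" for y by simp
  ultimately show ?thesis
    unfolding patches_def by (auto; metis diff_add_cancel translate_translate mem_translate)
qed

lemma delone_translate:
  assumes "delone A"
  shows "delone (translate t A)"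
  unfolding delone_def
proof
  obtain e where e: "e > 0" "\<And>p q. p \<in> A \<Longrightarrow> q \<in> A \<Longrightarrow> dist p q < e \<Longrightarrow> p = q"
    using assms unfolding delone_def uniform_discrete_def by blast
  have "p = q" if "p + t \<in> A" "q + t \<in> A" "dist p q < e" for p q
    using e(2)[of "p + t" "q + t"] that by simp
  with e(1) show "uniform_discrete (translate t A)"
    unfolding uniform_discrete_def by auto
  obtain R where R: "\<And>p. \<exists>q\<in>A. dist p q \<le> R"
    using assms unfolding delone_def relatively_dense_def by blast
  have "\<exists>q\<in>translate t A. dist p q \<le> R" for p
  proof -
    obtain q where "q \<in> A" "dist (p + t) q \<le> R" using R by blast
    then show ?thesis by (intro bexI[of _ "q - t"]) (auto simp: dist_norm algebra_simps)
  qed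
  then show "relatively_dense (translate t A)"
    unfolding relatively_dense_def by blast
qed

lemma translate_in_delone_hull: "A \<in> delone_hull L \<Longrightarrow> translate t A \<in> delone_hull L"
  by (auto simp: delone_hull_def delone_translate)

lemma delone_nonempty: "delone A \<Longrightarrow> A \<noteq> {}"
  by (auto simp: delone_def relatively_dense_def)

text \<open>Near each of its points, a set whose patches are patches of \<open>L\<close> is a translated copy of \<open>L\<close> near
  some point of \<open>L\<close>.\<close>

lemma patch_occurs:
  assumes "patches A (cball 0 R) \<subseteq> patches L (cball 0 R)" "p \<in> A"
  obtains q where "q \<in> L" "\<And>v. norm v \<le> R \<Longrightarrow> p + v \<in> A \<longleftrightarrow> q + v \<in> L"
proof -
  have "translate p A \<inter> cball 0 R \<in> patches L (cball 0 R)"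
    using assms unfolding patches_def by blast
  then obtain q where q: "q \<in> L" "translate p A \<inter> cball 0 R = translate q L \<inter> cball 0 R"
    unfolding patches_def by blast
  have "p + v \<in> A \<longleftrightarrow> q + v \<in> L" if "norm v \<le> R" for v
    using that q(2) by (metis IntD1 IntI add.commute mem_cball_0 mem_translate)
  with q(1) that show thesis by blast
qed

text \<open>The two Delone constants of \<open>L\<close> are visible in its patches. They are shared by all sets with patches
  from \<open>L\<close>, even if these sets are not known to be Delone beforehand.\<close>

lemma uniform_delone_constants:
  assumes "delone L"
  obtains e R where "e > 0" "R > 0"
    "\<And>A p q. \<lbrakk>\<And>K. compact K \<Longrightarrow> patches A K \<subseteq> patches L K; p \<in> A; q \<in> A; dist p q < e\<rbrakk> \<Longrightarrow> p = q"
    "\<And>A p. \<lbrakk>\<And>K. compact K \<Longrightarrow> patches A K \<subseteq> patches L K; A \<noteq> {}\<rbrakk> \<Longrightarrow> \<exists>q\<in>A. dist p q \<le> R"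
proof -
  obtain e where e: "e > 0" "\<And>p q. p \<in> L \<Longrightarrow> q \<in> L \<Longrightarrow> dist p q < e \<Longrightarrow> p = q"
    using assms unfolding delone_def uniform_discrete_def by blast
  obtain R where R: "\<And>p. \<exists>q\<in>L. dist p q \<le> R"
    using assms unfolding delone_def relatively_dense_def by blast
  have sep: "p = q" if A: "\<And>K. compact K \<Longrightarrow> patches A K \<subseteq> patches L K"
    and pq: "p \<in> A" "q \<in> A" "dist p q < e" for A p q
  proof -
    obtain p' where p': "p' \<in> L" "\<And>v. norm v \<le> e \<Longrightarrow> p + v \<in> A \<longleftrightarrow> p' + v \<in> L"
      using patch_occurs[OF A[OF compact_cball] pq(1)] by blast
    have "p' + (q - p) \<in> L"
      using pq p'(2)[of "q - p"] by (auto simp: dist_norm norm_minus_commute)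
    then have "p' = p' + (q - p)"
      using pq(3) by (intro e(2) p'(1)) (simp_all add: dist_norm norm_minus_commute)
    then show ?thesis by simp
  qed
  have dense: "\<exists>q\<in>A. dist p q \<le> max R 1"
    if A: "\<And>K. compact K \<Longrightarrow> patches A K \<subseteq> patches L K" and ne: "A \<noteq> {}" for A p
  proof -
    obtain o' where o': "o' \<in> A" using ne by blast
    obtain p' where p': "p' \<in> L"
      "\<And>v. norm v \<le> norm (p - o') + R \<Longrightarrow> o' + v \<in> A \<longleftrightarrow> p' + v \<in> L"
      using patch_occurs[OF A[OF compact_cball] o'] by blast
    obtain q where q: "q \<in> L" "dist (p' + (p - o')) q \<le> R" using R by blast
    have "norm (q - p') \<le> norm (p - o') + R"
      using q(2) norm_triangle_ineq[of "p - o'" "q - p' - (p - o')"]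
      by (simp add: dist_norm norm_minus_commute algebra_simps)
    then have "o' + (q - p') \<in> A" using p'(2)[of "q - p'"] q(1) by simp
    moreover have "dist p (o' + (q - p')) \<le> max R 1"
      using q(2) by (simp add: dist_norm algebra_simps)
    ultimately show ?thesis by blast
  qed
  show thesis
    by (rule that[OF e(1) _ sep dense]) simp
qed

lemma
  assumes "delone L"
  shows hull_uniformly_separated:
      "\<exists>e>0. \<forall>A\<in>delone_hull L. \<forall>p\<in>A. \<forall>q\<in>A. dist p q < e \<longrightarrow> p = q"
    and hull_uniformly_dense:
      "\<exists>R>0. \<forall>A\<in>delone_hull L. \<forall>p. \<exists>q\<in>A. dist p q \<le> R"
proof -
  obtain e R where eR: "e > 0" "R > 0"
    and e: "\<And>A p q. \<lbrakk>\<And>K. compact K \<Longrightarrow> patches A K \<subseteq> patches L K; p \<in> A; q \<in> A; dist p q < e\<rbrakk> \<Longrightarrow> p = q"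
    and R: "\<And>A p. \<lbrakk>\<And>K. compact K \<Longrightarrow> patches A K \<subseteq> patches L K; A \<noteq> {}\<rbrakk> \<Longrightarrow> \<exists>q\<in>A. dist p q \<le> R"
    by (fact uniform_delone_constants[OF assms(1)])
  have hull: "patches A K \<subseteq> patches L K" "A \<noteq> {}" if "A \<in> delone_hull L" "compact K" for A K
    using that by (auto simp: delone_hull_def dest: delone_nonempty)
  have "p = q" if "A \<in> delone_hull L" "p \<in> A" "q \<in> A" "dist p q < e" for A p q
    using hull(1)[OF that(1)] that(2-) by (rule e)
  with eR(1) show "\<exists>e>0. \<forall>A\<in>delone_hull L. \<forall>p\<in>A. \<forall>q\<in>A. dist p q < e \<longrightarrow> p = q"
    by (intro exI[of _ e] conjI ballI impI)
  have "\<exists>q\<in>A. dist p q \<le> R" if "A \<in> delone_hull L" for A p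
    using hull(1)[OF that] hull(2)[OF that compact_empty] by (rule R)
  with eR(2) show "\<exists>R>0. \<forall>A\<in>delone_hull L. \<forall>p. \<exists>q\<in>A. dist p q \<le> R"
    by (intro exI[of _ R] conjI ballI allI)
qed

lemma delone_hull_I:
  assumes "delone L" "A \<noteq> {}" "\<And>K. compact K \<Longrightarrow> patches A K \<subseteq> patches L K"
  shows "A \<in> delone_hull L"
proof -
  obtain e R where eR: "e > 0" "R > 0"
    "\<And>A p q. \<lbrakk>\<And>K. compact K \<Longrightarrow> patches A K \<subseteq> patches L K; p \<in> A; q \<in> A; dist p q < e\<rbrakk> \<Longrightarrow> p = q"
    "\<And>A p. \<lbrakk>\<And>K. compact K \<Longrightarrow> patches A K \<subseteq> patches L K; A \<noteq> {}\<rbrakk> \<Longrightarrow> \<exists>q\<in>A. dist p q \<le> R"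
    by (fact uniform_delone_constants[OF assms(1)])
  have "uniform_discrete A"
    unfolding uniform_discrete_def using eR(1) eR(3)[OF assms(3)] by blast
  moreover have "relatively_dense A"
    unfolding relatively_dense_def using eR(4)[OF assms(3,2)] by blast
  ultimately show ?thesis
    using assms(3) by (simp add: delone_hull_def delone_def)
qed

text \<open>A diagonal argument: finite local complexity leaves finitely many possibilities for each of the
  central patches of radius \<open>k\<close>, so a subsequence makes all of them eventually constant.\<close>

lemma hull_locally_compact_at_origin:
  fixes X :: "nat \<Rightarrow> 'a::euclidean_space set"
  assumes "delone L" "finite_local_complexity L"
    and X: "\<And>n. X n \<in> delone_hull L" "\<And>n. 0 \<in> X n"
  obtains r A where "strict_mono r" "A \<in> delone_hull L" "0 \<in> A" "locally_tends (X \<circ> r) A"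
proof -
  define P where "P = (\<lambda>(k::nat) (s::nat \<Rightarrow> nat). \<exists>p. \<forall>n. central_patch k (X (s n)) = p)"
  interpret subseqs P
  proof
    fix k :: nat and s :: "nat \<Rightarrow> nat" assume "strict_mono s"
    have "central_patch k (X (s n)) \<in> patches L (cball 0 (real k))" for n
    proof -
      have "translate 0 (X (s n)) \<inter> cball 0 (real k) \<in> patches (X (s n)) (cball 0 (real k))"
        unfolding patches_def using X(2) by blast
      moreover have "patches (X (s n)) (cball 0 (real k)) \<subseteq> patches L (cball 0 (real k))"
        using X(1)[of "s n"] by (simp add: delone_hull_def)
      ultimately have "translate 0 (X (s n)) \<inter> cball 0 (real k) \<in> patches L (cball 0 (real k))"
        by blast
      then show ?thesis by (simp add: central_patch_def)
    qed
    then have "finite (range (\<lambda>n. central_patch k (X (s n))))"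
      using assms(2) unfolding finite_local_complexity_def
      by (meson compact_cball finite_subset image_subsetI)
    then obtain p where "infinite {n. central_patch k (X (s n)) = p}"
      using inf_img_fin_dom[of "\<lambda>n. central_patch k (X (s n))" UNIV] by (auto simp: vimage_def)
    then obtain r' :: "nat \<Rightarrow> nat" where "strict_mono r'" "\<And>n. r' n \<in> {n. central_patch k (X (s n)) = p}"
      using infinite_enumerate by blast
    then show "\<exists>r'. strict_mono r' \<and> P k (s \<circ> r')"
      unfolding P_def by auto
  qed
  have "\<exists>p. \<forall>n. central_patch k (X (diagseq (Suc k + n))) = p" for k :: nat
  proof -
    have "P k (diagseq \<circ> (+) (Suc k))"
      by (rule diagseq_holds) (auto simp: P_def)
    then show ?thesis by (simp add: P_def o_def)
  qed
  then obtain p where p: "\<And>k n. central_patch k (X (diagseq (Suc k + n))) = p k"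
    by metis
  have p: "central_patch k (X (diagseq n)) = p k" if "n > k" for k n :: nat
    using p[of k "n - Suc k"] that by simp
  define A where "A = (\<Union>k. p k)"
  have A_iff: "v \<in> A \<longleftrightarrow> v \<in> X (diagseq n)" if "norm v \<le> real k" "n > k" for v k n
  proof
    assume "v \<in> A"
    then obtain j where "v \<in> p j" by (auto simp: A_def)
    moreover have "central_patch j (X (diagseq (Suc (max j k)))) = p j" by (rule p) simp
    ultimately have "v \<in> central_patch j (X (diagseq (Suc (max j k))))" by simp
    then have "v \<in> central_patch k (X (diagseq (Suc (max j k))))" using that by auto
    then have "v \<in> p k" using p[of k "Suc (max j k)"] by simp
    then have "v \<in> central_patch k (X (diagseq n))" using p that by simp
    then show "v \<in> X (diagseq n)" by simp
  next
    assume "v \<in> X (diagseq n)"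
    then have "v \<in> central_patch k (X (diagseq n))" using that by simp
    then show "v \<in> A" using p that by (auto simp: A_def)
  qed
  have tends: "locally_tends (X \<circ> diagseq) A"
    unfolding locally_tends_def
  proof
    fix R :: real
    obtain k :: nat where k: "R \<le> k" using real_arch_simple by blast
    have "central_patch R ((X \<circ> diagseq) n) = central_patch R A" if "n > k" for n
      using A_iff[of _ k n] k that by (intro set_eqI) auto
    then show "\<forall>\<^sub>F n in sequentially. central_patch R ((X \<circ> diagseq) n) = central_patch R A"
      using eventually_gt_at_top by (rule eventually_mono[rotated])
  qed
  have "0 \<in> A" using A_iff[of 0 0 1] X(2) by simp
  have "patches A K \<subseteq> patches L K" if K: "compact K" for K
  proof
    fix pt assume "pt \<in> patches A K"
    then obtain q where q: "q \<in> A" "pt = translate q A \<inter> K" unfolding patches_def by blast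
    obtain b where b: "\<And>v. v \<in> K \<Longrightarrow> norm v \<le> b"
      using compact_imp_bounded[OF K] bounded_iff by metis
    obtain n where n: "\<And>v. norm v \<le> norm q + \<bar>b\<bar> \<Longrightarrow> v \<in> X (diagseq n) \<longleftrightarrow> v \<in> A"
      using eventually_happens'[OF sequentially_bot locally_tendsD[OF tends, of "norm q + \<bar>b\<bar>"]]
      by (auto simp: o_def)
    have "v + q \<in> A \<longleftrightarrow> v + q \<in> X (diagseq n)" if "v \<in> K" for v
      using n[of "v + q"] b[OF that] norm_triangle_ineq[of v q] by auto
    then have "pt = translate q (X (diagseq n)) \<inter> K" using q(2) by auto
    moreover have "q \<in> X (diagseq n)" using n[of q] q(1) by auto
    ultimately have "pt \<in> patches (X (diagseq n)) K" unfolding patches_def by blast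
    then show "pt \<in> patches L K" using X(1) K unfolding delone_hull_def by blast
  qed
  then have "A \<in> delone_hull L"
    using assms(1) \<open>0 \<in> A\<close> by (intro delone_hull_I) auto
  with subseq_diagseq \<open>0 \<in> A\<close> tends that show thesis by blast
qed

lemma hull_sequentially_compact:
  fixes X :: "nat \<Rightarrow> 'a::euclidean_space set"
  assumes "delone L" "finite_local_complexity L" and X: "\<And>n. X n \<in> delone_hull L"
  obtains r A where "strict_mono r" "A \<in> delone_hull L" "(\<lambda>n. delone_dist (X (r n)) A) \<longlonglongrightarrow> 0"
proof -
  obtain R where R: "\<forall>A\<in>delone_hull L. \<forall>p. \<exists>q\<in>A. dist p q \<le> R"
    using hull_uniformly_dense[OF assms(1)] by blast
  have "\<exists>q\<in>X n. dist 0 q \<le> R" for n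
    using X R by blast
  then obtain q where q: "\<And>n. q n \<in> X n" "\<And>n. q n \<in> cball 0 R" by (metis mem_cball)
  obtain l r1 where r1: "strict_mono r1" "(q \<circ> r1) \<longlonglongrightarrow> l"
    using compact_imp_seq_compact[OF compact_cball] q(2) unfolding seq_compact_def by blast
  obtain r2 A where r2: "strict_mono r2" "A \<in> delone_hull L"
      "locally_tends ((\<lambda>n. translate (q (r1 n)) (X (r1 n))) \<circ> r2) A"
    by (rule hull_locally_compact_at_origin[OF assms(1,2), of "\<lambda>n. translate (q (r1 n)) (X (r1 n))"])
      (auto simp: X q(1) translate_in_delone_hull)
  have "(\<lambda>n. - q (r1 (r2 n))) \<longlonglongrightarrow> - l"
    using LIMSEQ_subseq_LIMSEQ[OF r1(2) r2(1)] by (intro tendsto_minus) (simp add: o_def)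
  from locally_tends_imp_delone_dist_tendsto_0[OF r2(3) this]
  have "(\<lambda>n. delone_dist (X (r1 (r2 n))) (translate (- l) A)) \<longlonglongrightarrow> 0" by simp
  then show thesis
    using that[of "r1 \<circ> r2" "translate (- l) A"] strict_mono_o[OF r1(1) r2(1)]
      translate_in_delone_hull[OF r2(2)] by simp
qed

section \<open>Zero density forces empty regions to be negligible\<close>

lemma compact_vh_boundary:
  assumes "compact K" "compact A"
  shows "compact (vh_boundary K A)"
proof -
  have "bounded {a + k |a k. a \<in> A \<and> k \<in> K}"
    using compact_sums[OF assms(2,1)] by (rule compact_imp_bounded)
  then have "bounded ({a + k |a k. a \<in> A \<and> k \<in> K} - A)"
    by (rule bounded_subset) blast
  then have "compact (closure ({a + k |a k. a \<in> A \<and> k \<in> K} - A))"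
    by simp
  moreover have "{b - k |b k. b \<in> closure (- A) \<and> k \<in> K} =
      (\<Union>b\<in>closure (- A). \<Union>k\<in>K. {b - k})" by blast
  then have "closed {b - k |b k. b \<in> closure (- A) \<and> k \<in> K}"
    using closed_compact_differences[OF closed_closure assms(1)] by simp
  then have "compact ({b - k |b k. b \<in> closure (- A) \<and> k \<in> K} \<inter> A)"
    using assms(2) by (rule closed_Int_compact)
  ultimately show ?thesis
    unfolding vh_boundary_def by (rule compact_Un)
qed

lemma van_hove_measure_pos:
  assumes "van_hove \<Lambda>"
  shows "measure lebesgue (\<Lambda> n) > 0"
proof -
  have "compact (\<Lambda> n)" "interior (\<Lambda> n) \<noteq> {}"
    using assms by (auto simp: van_hove_def)
  then have "\<not> negligible (\<Lambda> n)"
    using open_not_negligible negligible_subset interior_subset open_interior by metis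
  then have "measure lebesgue (\<Lambda> n) \<noteq> 0"
    using negligible_iff_measure lmeasurable_compact[OF \<open>compact (\<Lambda> n)\<close>] by blast
  then show ?thesis by (simp add: zero_less_measure_iff)
qed

text \<open>A point of \<open>A \<inter> \<Lambda>\<^sub>n\<close> lies within \<open>r\<close> of a point of \<open>D\<close>, and this point is in \<open>\<Lambda>\<^sub>n\<close> unless the
  given one is in the boundary layer. So the balls of radius \<open>r\<close> about \<open>D \<inter> \<Lambda>\<^sub>n\<close>, which are
  few when \<open>D\<close> has density zero, cover all of \<open>A \<inter> \<Lambda>\<^sub>n\<close> but the boundary layer.\<close>

lemma zero_density_dense_region_negligible:
  fixes D :: "'a::euclidean_space set"
  assumes vh: "van_hove \<Lambda>" and dens: "upper_density \<Lambda> D = 0"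
    and fin: "\<And>n. finite (D \<inter> \<Lambda> n)" and A: "closed A" "\<And>p. p \<in> A \<Longrightarrow> \<exists>q\<in>D. dist p q \<le> r"
  shows "(\<lambda>n. measure lebesgue (A \<inter> \<Lambda> n) / measure lebesgue (\<Lambda> n)) \<longlonglongrightarrow> 0"
proof -
  define f where "f n = real (card (D \<inter> \<Lambda> n)) / measure lebesgue (\<Lambda> n)" for n
  define g where "g n = measure lebesgue (vh_boundary (cball 0 r) (\<Lambda> n)) / measure lebesgue (\<Lambda> n)" for n
  define c where "c = measure lebesgue (cball (0::'a) r)"
  have cpt: "compact (\<Lambda> n)" for n using vh by (auto simp: van_hove_def)
  have "0 \<le> liminf (\<lambda>n. ereal (f n))"
    by (rule Liminf_bounded) (simp add: f_def)
  moreover have "limsup (\<lambda>n. ereal (f n)) = 0"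
    using dens by (simp add: upper_density_def f_def)
  moreover have "liminf (\<lambda>n. ereal (f n)) \<le> limsup (\<lambda>n. ereal (f n))"
    by (rule Liminf_le_Limsup) simp
  ultimately have "(\<lambda>n. ereal (f n)) \<longlonglongrightarrow> 0"
    by (simp add: tendsto_iff_Liminf_eq_Limsup)
  then have f0: "f \<longlonglongrightarrow> 0" by (simp add: zero_ereal_def)
  have g0: "g \<longlonglongrightarrow> 0"
    using vh unfolding van_hove_def g_def by simp
  have bound: "measure lebesgue (A \<inter> \<Lambda> n) / measure lebesgue (\<Lambda> n) \<le> f n * c + g n" for n
  proof -
    let ?U = "\<Union>q\<in>D \<inter> \<Lambda> n. cball q r" and ?B = "vh_boundary (cball 0 r) (\<Lambda> n)"
    have "A \<inter> \<Lambda> n \<subseteq> ?U \<union> ?B"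
    proof
      fix p assume p: "p \<in> A \<inter> \<Lambda> n"
      then obtain q where q: "q \<in> D" "dist p q \<le> r" using A(2) by blast
      show "p \<in> ?U \<union> ?B"
      proof (cases "q \<in> \<Lambda> n")
        case True
        with q show ?thesis by (auto simp: dist_commute)
      next
        case False
        then have "q \<in> closure (- \<Lambda> n)" by (simp add: closure_def)
        moreover have "q - p \<in> cball 0 r" "p = q - (q - p)"
          using q(2) by (auto simp: dist_norm norm_minus_commute)
        ultimately have "p \<in> {b - k |b k. b \<in> closure (- \<Lambda> n) \<and> k \<in> cball 0 r}" by blast
        with p show ?thesis by (auto simp: vh_boundary_def)
      qed
    qed
    moreover have U: "?U \<in> lmeasurable"
      using fin[of n] by (intro lmeasurable_compact compact_UN) auto
    moreover have B: "?B \<in> lmeasurable"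
      by (intro lmeasurable_compact compact_vh_boundary cpt compact_cball)
    ultimately have "measure lebesgue (A \<inter> \<Lambda> n) \<le> measure lebesgue (?U \<union> ?B)"
      using closed_Int_compact[OF A(1) cpt]
      by (intro measure_mono_fmeasurable) (auto intro: lmeasurable_compact fmeasurableD fmeasurable.Un)
    also have "\<dots> \<le> measure lebesgue ?U + measure lebesgue ?B"
      using U B by (intro measure_Un_le) (auto intro: fmeasurableD)
    also have "measure lebesgue ?U \<le> (\<Sum>q\<in>D \<inter> \<Lambda> n. measure lebesgue (cball q r))"
      using fin[of n] by (intro measure_UNION_le) auto
    also have "\<dots> = (\<Sum>q\<in>D \<inter> \<Lambda> n. c)"
    proof (rule sum.cong)
      show "measure lebesgue (cball q r) = c" for q :: 'a
        by (cases "r \<ge> 0") (simp_all add: c_def content_cball)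
    qed simp
    also have "\<dots> = card (D \<inter> \<Lambda> n) * c" by simp
    finally show ?thesis
      using van_hove_measure_pos[OF vh, of n]
      by (simp add: f_def g_def divide_simps)
  qed
  have "(\<lambda>n. f n * c + g n) \<longlonglongrightarrow> 0 * c + 0"
    by (intro tendsto_intros f0 g0)
  then have lim: "(\<lambda>n. f n * c + g n) \<longlonglongrightarrow> 0" by simp
  show ?thesis
  proof (rule real_tendsto_sandwich[OF _ _ tendsto_const lim])
    show "\<forall>\<^sub>F n in sequentially. 0 \<le> measure lebesgue (A \<inter> \<Lambda> n) / measure lebesgue (\<Lambda> n)"
      by (rule always_eventually) simp
    show "\<forall>\<^sub>F n in sequentially. measure lebesgue (A \<inter> \<Lambda> n) / measure lebesgue (\<Lambda> n) \<le> f n * c + g n"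
      by (rule always_eventually, rule allI, rule bound)
  qed
qed


section \<open>Moving a ball until it touches a closed set\<close>

text \<open>The ball of radius \<open>\<rho>\<close> about \<open>q\<close> is moved straight towards \<open>t\<close> and stopped when it first touches \<open>T\<close>.
  The contact point lies on the front half of the sphere, since otherwise there would have been an
  earlier contact.\<close>

lemma first_contact:
  fixes T :: "'a::euclidean_space set"
  assumes T: "closed T" "t \<in> T" and hole: "\<And>p. p \<in> T \<Longrightarrow> \<rho> < dist q p" and "0 < \<rho>"
  obtains c p where "p \<in> T" "dist c p = \<rho>" "\<And>p'. p' \<in> T \<Longrightarrow> \<rho> \<le> dist c p'" "(t - q) \<bullet> (c - p) \<le> 0"
proof -
  define m where "m l = q + l *\<^sub>R (t - q)" for l :: real
  define f where "f l = infdist (m l) T" for l :: real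
  have ne: "T \<noteq> {}" using T(2) by blast
  have cont: "continuous_on U f" for U
    unfolding f_def m_def by (intro continuous_intros)
  define S where "S = {l \<in> {0..1}. f l \<le> \<rho>}"
  have "S = {0..1} \<inter> {l. f l \<le> \<rho>}" by (auto simp: S_def)
  moreover have "closed {l. f l \<le> \<rho>}"
    using cont[of UNIV] by (intro closed_Collect_le continuous_on_const) auto
  ultimately have "compact S"
    by (simp add: compact_Int_closed)
  have "1 \<in> S"
    using \<open>0 < \<rho>\<close> T(2) by (simp add: S_def f_def m_def)
  then obtain l where l: "l \<in> S" "\<And>l'. l' \<in> S \<Longrightarrow> l \<le> l'"
    using compact_attains_inf[OF \<open>compact S\<close>] by auto
  have before: "\<rho> < f l'" if "0 \<le> l'" "l' < l" for l'
    using l that unfolding S_def by force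
  obtain p0 where "p0 \<in> T" "f 0 = dist q p0"
    using infdist_attains_inf[OF T(1) ne, of "m 0"] by (auto simp: f_def m_def)
  then have "f 0 > \<rho>" using hole by simp
  then have "0 < l" using l(1) by (cases "l = 0") (auto simp: S_def)
  have "f l = \<rho>"
  proof (rule ccontr)
    assume neq: "f l \<noteq> \<rho>"
    obtain l' where "0 \<le> l'" "l' \<le> l" "f l' = \<rho>"
      using IVT2'[of f l \<rho> 0] cont l(1) \<open>f 0 > \<rho>\<close> by (auto simp: S_def)
    with before[of l'] neq show False by (cases "l' = l") auto
  qed
  obtain p where "p \<in> T" "infdist (m l) T = dist (m l) p"
    using infdist_attains_inf[OF T(1) ne] by blast
  with \<open>f l = \<rho>\<close> have p: "p \<in> T" "dist (m l) p = \<rho>" by (simp_all add: f_def)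
  have "\<rho> \<le> dist (m l) p'" if "p' \<in> T" for p'
    using infdist_le[OF that, of "m l"] \<open>f l = \<rho>\<close> by (simp add: f_def)
  moreover have "(t - q) \<bullet> (m l - p) \<le> 0"
  proof (rule ccontr)
    define k where "k = (t - q) \<bullet> (m l - p)"
    define n where "n = (t - q) \<bullet> (t - q)"
    assume "\<not> (t - q) \<bullet> (m l - p) \<le> 0"
    then have k: "k > 0" by (simp add: k_def)
    then have n: "n > 0" unfolding n_def k_def by (metis inner_gt_zero_iff inner_zero_left less_irrefl)
    \<comment> \<open>stepping back by \<open>h\<close> would bring the centre closer to \<open>p\<close>\<close>
    define h where "h = min l (k / n)"
    have h: "h > 0" "h \<le> l" "h * n \<le> k"
      using k n \<open>0 < l\<close> by (auto simp: h_def min_def field_simps split: if_splits)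
    have expand: "(norm (a - h *\<^sub>R b))\<^sup>2 = (norm a)\<^sup>2 - 2 * h * (b \<bullet> a) + h * (h * (b \<bullet> b))" for a b :: 'a
      by (simp add: power2_norm_eq_inner inner_diff_left inner_diff_right inner_commute)
    have step: "dist (m (l - h)) p = norm ((m l - p) - h *\<^sub>R (t - q))"
      by (simp add: m_def dist_norm algebra_simps)
    have "\<rho> < dist (m (l - h)) p"
      using before[of "l - h"] h infdist_le[OF p(1), of "m (l - h)"] by (simp add: f_def)
    then have "\<rho>\<^sup>2 < (dist (m (l - h)) p)\<^sup>2"
      using \<open>0 < \<rho>\<close> by (intro power_strict_mono) auto
    also have "(dist (m (l - h)) p)\<^sup>2 = (dist (m l) p)\<^sup>2 - 2 * h * k + h * (h * n)"
      using step expand by (simp add: k_def n_def dist_norm)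
    also have "\<dots> \<le> \<rho>\<^sup>2 - 2 * h * k + h * k"
      using h p(2) by (auto intro!: mult_left_mono)
    also have "\<dots> < \<rho>\<^sup>2" using h k by simp
    finally have "\<rho>\<^sup>2 < \<rho>\<^sup>2" .
    then show False by simp
  qed
  ultimately show thesis using p that by blast
qed

section \<open>Coincidences of pairs in a closed invariant relation of density zero\<close>

text \<open>The case \<open>s = 0\<close> is the one of interest. Nonzero \<open>s\<close> are needed because a pair close to one with
  common points may have these points only up to a small shift.\<close>

definition coincidences :: "'a::euclidean_space \<Rightarrow> 'a set \<Rightarrow> 'a set \<Rightarrow> 'a set" where
  "coincidences s x y = x \<inter> translate s y"

lemma mem_coincidences [simp]: "q \<in> coincidences s x y \<longleftrightarrow> q \<in> x \<and> q + s \<in> y"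
  by (simp add: coincidences_def)

lemma locally_tends_Int:
  assumes "locally_tends X A" "locally_tends Y B"
  shows "locally_tends (\<lambda>n. X n \<inter> Y n) (A \<inter> B)"
  unfolding locally_tends_def
proof
  fix R
  show "\<forall>\<^sub>F n in sequentially. central_patch R (X n \<inter> Y n) = central_patch R (A \<inter> B)"
    using locally_tendsD[OF assms(1), of R] locally_tendsD[OF assms(2), of R]
    by eventually_elim auto
qed

text \<open>The properties that the equicontinuous structure relation inherits from the continuity and
  equivariance of its factor map, together with the zero density that statistical coincidence gives.\<close>

locale coincidence_relation =
  fixes L :: "'a::euclidean_space set" and \<Lambda> :: "nat \<Rightarrow> 'a set" and E :: "('a set \<times> 'a set) set"
  assumes delone: "delone L" and flc: "finite_local_complexity L" and van_hove: "van_hove \<Lambda>"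
    and hull: "E \<subseteq> delone_hull L \<times> delone_hull L"
    and translates: "(x, y) \<in> E \<Longrightarrow> (translate t x, translate t y) \<in> E"
    and limits: "\<lbrakk>\<And>n. (X n, Y n) \<in> E; x \<in> delone_hull L; y \<in> delone_hull L;
      (\<lambda>n. delone_dist (X n) x) \<longlonglongrightarrow> 0; (\<lambda>n. delone_dist (Y n) y) \<longlonglongrightarrow> 0\<rbrakk> \<Longrightarrow> (x, y) \<in> E"
    and zero_density: "(x, y) \<in> E \<Longrightarrow> upper_density \<Lambda> ((x - y) \<union> (y - x)) = 0"
begin

text \<open>Once the first set of each pair contains the origin, the position \<open>s\<^sub>n\<close> of a point of the second
  set is the only continuous parameter of the pair near the origin. All else is eventually constant on each
  ball.\<close>

lemma limit_pair:
  fixes X Y :: "nat \<Rightarrow> 'a set"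
  assumes E: "\<And>n. (X n, Y n) \<in> E" and "\<And>n. 0 \<in> X n" "\<And>n. s n \<in> Y n" "\<And>n. norm (s n) \<le> B"
  obtains r x y u where "strict_mono r" "(x, y) \<in> E" "0 \<in> x" "u \<in> y" "(s \<circ> r) \<longlonglongrightarrow> u"
    "locally_tends (X \<circ> r) x" "locally_tends ((\<lambda>n. translate (s n) (Y n)) \<circ> r) (translate u y)"
    "locally_tends ((\<lambda>n. coincidences (s n) (X n) (Y n)) \<circ> r) (coincidences u x y)"
proof -
  have hullXY: "X n \<in> delone_hull L" "Y n \<in> delone_hull L" for n using E hull by blast+
  have "\<forall>n. s n \<in> cball 0 B" using assms(4) by simp
  then obtain u r1 where r1: "strict_mono r1" "(s \<circ> r1) \<longlonglongrightarrow> u"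
    using compact_imp_seq_compact[OF compact_cball[of "0::'a" B]] unfolding seq_compact_def by blast
  obtain r2 x where r2: "strict_mono r2" "x \<in> delone_hull L" "0 \<in> x" "locally_tends ((X \<circ> r1) \<circ> r2) x"
    by (rule hull_locally_compact_at_origin[OF delone flc, of "X \<circ> r1"]) (auto simp: hullXY assms)
  define r12 where "r12 = r1 \<circ> r2"
  obtain r3 z where r3: "strict_mono r3" "z \<in> delone_hull L" "0 \<in> z"
      "locally_tends (((\<lambda>n. translate (s n) (Y n)) \<circ> r12) \<circ> r3) z"
    by (rule hull_locally_compact_at_origin[OF delone flc, of "(\<lambda>n. translate (s n) (Y n)) \<circ> r12"])
      (auto simp: hullXY assms translate_in_delone_hull)
  define r where "r = r12 \<circ> r3"
  have r: "strict_mono r"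
    unfolding r_def r12_def using r1 r2 r3 by (intro strict_mono_o)
  have X: "locally_tends (X \<circ> r) x"
    using locally_tends_subseq[OF r2(4) r3(1)] by (simp add: r_def r12_def o_assoc)
  have Y: "locally_tends ((\<lambda>n. translate (s n) (Y n)) \<circ> r) z"
    using r3(4) by (simp add: r_def o_assoc)
  have s: "(s \<circ> r) \<longlonglongrightarrow> u"
    using LIMSEQ_subseq_LIMSEQ[OF r1(2) strict_mono_o[OF r2(1) r3(1)]]
    by (simp add: r_def r12_def o_assoc)
  define y where "y = translate (- u) z"
  have "(x, y) \<in> E"
  proof (rule limits)
    show "(X (r n), Y (r n)) \<in> E" for n by (rule E)
    show "x \<in> delone_hull L" "y \<in> delone_hull L"
      using r2 r3 by (auto simp: y_def translate_in_delone_hull)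
    show "(\<lambda>n. delone_dist (X (r n)) x) \<longlonglongrightarrow> 0"
      using locally_tends_imp_delone_dist_tendsto_0[OF X tendsto_const[of 0]] by simp
    have "(\<lambda>n. - s (r n)) \<longlonglongrightarrow> - u" using s by (intro tendsto_minus) (simp add: o_def)
    from locally_tends_imp_delone_dist_tendsto_0[OF Y this]
    show "(\<lambda>n. delone_dist (Y (r n)) y) \<longlonglongrightarrow> 0" by (simp add: y_def)
  qed
  moreover have z: "translate u y = z" by (simp add: y_def)
  moreover have "u \<in> y" using r3(3) by (simp add: y_def)
  moreover have "locally_tends ((\<lambda>n. coincidences (s n) (X n) (Y n)) \<circ> r) (coincidences u x y)"
    using locally_tends_Int[OF X Y] z by (simp add: coincidences_def o_def)
  ultimately show thesis
    using that[of r x y u] r r2(3) s X Y by simp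
qed

lemma uniform_discrete_pair:
  assumes "(x, y) \<in> E"
  shows "uniform_discrete x" "uniform_discrete y"
  using assms hull by (auto simp: delone_hull_def delone_def)

lemma closed_coincidences:
  assumes "(x, y) \<in> E"
  shows "closed (coincidences s x y)"
proof -
  have "(x, y) \<in> delone_hull L \<times> delone_hull L" using assms hull by blast
  then have "uniform_discrete x"  "uniform_discrete (translate s y)"
    using delone_translate by (auto simp: delone_hull_def delone_def)
  then show ?thesis
    unfolding coincidences_def by (intro closed_Int uniform_discrete_imp_closed)
qed

lemma difference_dense_region_negligible:
  assumes "(x, y) \<in> E" "closed A" "\<And>p. p \<in> A \<Longrightarrow> \<exists>q\<in>(x - y) \<union> (y - x). dist p q \<le> r"
  shows "(\<lambda>n. measure lebesgue (A \<inter> \<Lambda> n) / measure lebesgue (\<Lambda> n)) \<longlonglongrightarrow> 0"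
proof (rule zero_density_dense_region_negligible[OF van_hove zero_density[OF assms(1)] _ assms(2,3)])
  fix n
  have "bounded (\<Lambda> n)" using van_hove by (auto simp: van_hove_def compact_imp_bounded)
  then have "finite (x \<inter> \<Lambda> n)" "finite (y \<inter> \<Lambda> n)"
    using uniform_discrete_pair[OF assms(1)]
    by (metis uniform_discrete_finite_iff bounded_Int uniform_discrete_subset Int_lower1)+
  then show "finite (((x - y) \<union> (y - x)) \<inter> \<Lambda> n)"
    by (rule rev_finite_subset[OF finite_UnI]) auto
qed

lemma difference_not_relatively_dense:
  assumes "(x, y) \<in> E"
  shows "\<exists>p. \<forall>q\<in>(x - y) \<union> (y - x). r < dist p q"
proof (rule ccontr)
  assume "\<not> ?thesis"
  then have "\<And>p. \<exists>q\<in>(x - y) \<union> (y - x). dist p q \<le> r" by (meson linorder_not_le)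
  then have "(\<lambda>n. measure lebesgue (UNIV \<inter> \<Lambda> n) / measure lebesgue (\<Lambda> n)) \<longlonglongrightarrow> 0"
    by (intro difference_dense_region_negligible[OF assms]) auto
  moreover have "measure lebesgue (UNIV \<inter> \<Lambda> n) / measure lebesgue (\<Lambda> n) = 1" for n
    using van_hove_measure_pos[OF van_hove, of n] by simp
  ultimately show False by (simp add: LIMSEQ_const_iff)
qed

lemma strongly_proximal:
  assumes "(x, y) \<in> E"
  shows "\<exists>t. central_patch R (translate t x) = central_patch R (translate t y)"
proof -
  obtain t where t: "\<And>q. q \<in> (x - y) \<union> (y - x) \<Longrightarrow> R < dist t q"
    using difference_not_relatively_dense[OF assms] by blast
  have "v + t \<in> x \<longleftrightarrow> v + t \<in> y" if "norm v \<le> R" for v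
    using t[of "v + t"] that by (auto simp: dist_norm)
  then show ?thesis by (intro exI[of _ t] set_eqI) auto
qed


section \<open>Half-spaces without coincidences\<close>

text \<open>The inner normals \<open>w\<close> of those half-spaces \<open>{q. w \<bullet> q > 0}\<close> that some pair leaves free of common
  points although it has one on the bounding hyperplane.\<close>

definition free_directions :: "'a set" where
  "free_directions = {w. norm w = 1 \<and> (\<exists>x y. (x, y) \<in> E \<and> 0 \<in> x \<inter> y \<and> (\<forall>q\<in>x \<inter> y. w \<bullet> q \<le> 0))}"

text \<open>The condition \<open>w\<^sub>n \<bullet> q \<le> d\<^sub>n * (norm q)\<^sup>2\<close> says that \<open>q\<close> is outside the ball of radius \<open>1 / (2 * d\<^sub>n)\<close> that
  touches the origin with inner normal \<open>w\<^sub>n\<close>. As \<open>d\<^sub>n\<close> vanishes, these balls grow to a half-space.\<close>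

lemma free_direction_limit:
  fixes X Y :: "nat \<Rightarrow> 'a set"
  assumes E: "\<And>n. (X n, Y n) \<in> E" and X: "\<And>n. 0 \<in> X n" and Y: "\<And>n. s n \<in> Y n" and s: "s \<longlonglongrightarrow> 0"
    and w: "w \<longlonglongrightarrow> l" "\<And>n. norm (w n) = 1" and d: "d \<longlonglongrightarrow> (0::real)"
    and half: "\<And>n q. q \<in> coincidences (s n) (X n) (Y n) \<Longrightarrow> w n \<bullet> q \<le> d n * (norm q)\<^sup>2"
  shows "l \<in> free_directions"
proof -
  obtain B where B: "\<And>n. norm (s n) \<le> B"
    using convergent_imp_Bseq[OF convergentI[OF s]] by (auto simp: Bseq_def)
  obtain r x y u where r: "strict_mono r" "(x, y) \<in> E" "0 \<in> x" "u \<in> y" "(s \<circ> r) \<longlonglongrightarrow> u"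
    "locally_tends ((\<lambda>n. coincidences (s n) (X n) (Y n)) \<circ> r) (coincidences u x y)"
    by (rule limit_pair[OF E X Y B]; rule that)
  have u: "u = 0"
    using LIMSEQ_subseq_LIMSEQ[OF s r(1)] r(5) LIMSEQ_unique by blast
  have "l \<bullet> q \<le> 0" if "q \<in> x \<inter> y" for q
  proof (rule tendsto_le[OF sequentially_bot])
    show "(\<lambda>n. w (r n) \<bullet> q) \<longlonglongrightarrow> l \<bullet> q"
      using LIMSEQ_subseq_LIMSEQ[OF w(1) r(1)] by (intro tendsto_intros) (simp add: o_def)
    show "(\<lambda>n. d (r n) * (norm q)\<^sup>2) \<longlonglongrightarrow> 0"
      using LIMSEQ_subseq_LIMSEQ[OF d r(1)] by (intro tendsto_mult_left_zero) (simp add: o_def)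
    show "\<forall>\<^sub>F n in sequentially. w (r n) \<bullet> q \<le> d (r n) * (norm q)\<^sup>2"
      using locally_tendsD[OF r(6), of "norm q"]
    proof eventually_elim
      case (elim n)
      then have "q \<in> coincidences (s (r n)) (X (r n)) (Y (r n))" using that u by simp
      then show ?case by (rule half)
    qed
  qed
  moreover have "norm l = 1"
    using tendsto_norm[OF w(1)] w(2) by (simp add: LIMSEQ_const_iff)
  ultimately show ?thesis
    using r u unfolding free_directions_def by auto
qed

lemma compact_free_directions: "compact free_directions"
proof -
  have "closed free_directions"
    unfolding closed_sequential_limits
  proof (intro allI impI, elim conjE)
    fix w l assume w: "\<forall>n. w n \<in> free_directions" "w \<longlonglongrightarrow> l"
    have "\<forall>n. \<exists>x y. (x, y) \<in> E \<and> 0 \<in> x \<and> 0 \<in> y \<and> (\<forall>q\<in>x \<inter> y. w n \<bullet> q \<le> 0)"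
      using w(1) unfolding free_directions_def by blast
    then obtain X Y where XY: "\<And>n. (X n, Y n) \<in> E" "\<And>n. 0 \<in> X n" "\<And>n. 0 \<in> Y n"
      "\<And>n. \<forall>q\<in>X n \<inter> Y n. w n \<bullet> q \<le> 0"
      by metis
    have "norm (w n) = 1" for n using w(1) by (simp add: free_directions_def)
    show "l \<in> free_directions"
      by (rule free_direction_limit[of X Y "\<lambda>_. 0" w l "\<lambda>_. 0"])
        (use XY w \<open>\<And>n. norm (w n) = 1\<close> in auto)
  qed
  moreover have "bounded free_directions"
    by (rule boundedI[of _ 1]) (auto simp: free_directions_def)
  ultimately show ?thesis by (simp add: compact_eq_bounded_closed)
qed

text \<open>The difference of a pair witnessing the free direction \<open>w\<close> is relatively dense in a half-space. As the pair
  may be translated along \<open>w\<close>, the position of the half-space is arbitrary.\<close>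

lemma free_direction_negligible:
  assumes "w \<in> free_directions"
  shows "(\<lambda>n. measure lebesgue ({p. 0 \<le> w \<bullet> p} \<inter> \<Lambda> n) / measure lebesgue (\<Lambda> n)) \<longlonglongrightarrow> 0"
proof -
  obtain x y where xy: "(x, y) \<in> E" "norm w = 1" and half: "\<And>q. q \<in> x \<Longrightarrow> q \<in> y \<Longrightarrow> w \<bullet> q \<le> 0"
    using assms unfolding free_directions_def by blast
  obtain R where R: "R > 0" "\<forall>A\<in>delone_hull L. \<forall>p. \<exists>q\<in>A. dist p q \<le> R"
    using hull_uniformly_dense[OF delone] by blast
  define k where "k = (R + 1) *\<^sub>R w"
  have "\<exists>q\<in>(translate k x - translate k y) \<union> (translate k y - translate k x). dist p q \<le> R"
    if "p \<in> {p. 0 \<le> w \<bullet> p}" for p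
  proof -
    have "translate k x \<in> delone_hull L" using xy hull translate_in_delone_hull by blast
    then obtain q where q: "q \<in> translate k x" "dist p q \<le> R" using R(2) by blast
    have "w \<bullet> (p - q) \<le> R"
      using norm_cauchy_schwarz[of w "p - q"] xy(2) q(2) by (simp add: dist_norm)
    moreover have "w \<bullet> k = R + 1" using xy(2) by (simp add: k_def dot_square_norm)
    ultimately have "w \<bullet> (q + k) > 0" using that by (simp add: inner_diff_right inner_add_right)
    then have "q \<notin> translate k y" using half[of "q + k"] q(1) by auto
    with q show ?thesis by blast
  qed
  moreover have "closed {p. 0 \<le> w \<bullet> p}" by (simp add: closed_halfspace_ge)
  ultimately show ?thesis
    using difference_dense_region_negligible[OF translates[OF xy(1)]] by blast
qed

text \<open>Otherwise finitely many of the negligible half-spaces would cover the space.\<close>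

lemma zero_notin_convex_hull_free_directions: "0 \<notin> convex hull free_directions"
proof
  assume "0 \<in> convex hull free_directions"
  then obtain S u where S: "finite S" "S \<subseteq> free_directions" "\<And>w. w \<in> S \<Longrightarrow> 0 \<le> u w" "sum u S = (1::real)"
      "(\<Sum>w\<in>S. u w *\<^sub>R w) = 0"
    unfolding convex_hull_explicit by blast
  have cover: "\<exists>w\<in>S. 0 \<le> w \<bullet> p" for p
  proof (rule ccontr)
    assume neg: "\<not> ?thesis"
    have "(\<Sum>w\<in>S. - (u w * (w \<bullet> p))) = 0"
      using arg_cong[OF S(5), of "\<lambda>v. v \<bullet> p"] by (simp add: inner_sum_left sum_negf)
    moreover have "0 \<le> - (u w * (w \<bullet> p))" if "w \<in> S" for w
      using neg that mult_nonneg_nonpos[OF S(3)[OF that], of "w \<bullet> p"] by auto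
    ultimately have "u w * (w \<bullet> p) = 0" if "w \<in> S" for w
      using sum_nonneg_eq_0_iff[OF S(1), of "\<lambda>w. - (u w * (w \<bullet> p))"] that by auto
    then have "u w = 0" if "w \<in> S" for w using neg that by force
    then show False using S(4) by simp
  qed
  define f where "f w n = measure lebesgue ({p. 0 \<le> w \<bullet> p} \<inter> \<Lambda> n) / measure lebesgue (\<Lambda> n)" for w n
  have "(\<lambda>n. \<Sum>w\<in>S. f w n) \<longlonglongrightarrow> (\<Sum>w\<in>S. 0)"
    unfolding f_def using S(2) by (intro tendsto_sum free_direction_negligible) blast
  moreover have "1 \<le> (\<Sum>w\<in>S. f w n)" for n
  proof -
    have cpt: "compact ({p. 0 \<le> w \<bullet> p} \<inter> \<Lambda> n)" for w
      using van_hove by (intro closed_Int_compact closed_halfspace_ge) (auto simp: van_hove_def)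
    have "\<Lambda> n = (\<Union>w\<in>S. {p. 0 \<le> w \<bullet> p} \<inter> \<Lambda> n)" using cover by blast
    then have "measure lebesgue (\<Lambda> n) \<le> (\<Sum>w\<in>S. measure lebesgue ({p. 0 \<le> w \<bullet> p} \<inter> \<Lambda> n))"
      using measure_UNION_le[OF S(1), of "\<lambda>w. {p. 0 \<le> w \<bullet> p} \<inter> \<Lambda> n" lebesgue] cpt
      by (metis (no_types, lifting) lmeasurable_compact fmeasurableD)
    then show ?thesis
      using van_hove_measure_pos[OF van_hove, of n]
      by (simp add: f_def sum_divide_distrib[symmetric])
  qed
  ultimately show False
    using LIMSEQ_le_const[of "\<lambda>n. \<Sum>w\<in>S. f w n" 0 1] by simp
qed


section \<open>Almost coincidences are coincidences\<close>

text \<open>A large ball without coincidences that touches a coincidence looks, from the point of contact, like a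
  half-space without coincidences. By compactness this applies, uniformly, to coincidences up to
  a small shift as well.\<close>

lemma contact_directions:
  assumes ab: "\<And>w. w \<in> free_directions \<Longrightarrow> b < a \<bullet> w" and "0 < (b::real)"
  shows "\<exists>\<rho>>0. \<exists>\<sigma>>0. \<forall>x y s c t. (x, y) \<in> E \<and> norm s < \<sigma> \<and> t \<in> coincidences s x y \<and> dist c t = \<rho> \<and>
    (\<forall>q\<in>coincidences s x y. \<rho> \<le> dist c q) \<longrightarrow> b / 2 * \<rho> < a \<bullet> (c - t)"
proof (rule ccontr)
  assume neg: "\<not> ?thesis"
  have "\<exists>x y s c t. (x, y) \<in> E \<and> norm s < 1 / real (Suc n) \<and> t \<in> coincidences s x y \<and>
      dist c t = real (Suc n) \<and> (\<forall>q\<in>coincidences s x y. real (Suc n) \<le> dist c q) \<and>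
      a \<bullet> (c - t) \<le> b / 2 * real (Suc n)" for n
  proof (rule ccontr)
    assume "\<not> ?thesis"
    then have "\<forall>x y s c t. (x, y) \<in> E \<and> norm s < 1 / real (Suc n) \<and> t \<in> coincidences s x y \<and>
        dist c t = real (Suc n) \<and> (\<forall>q\<in>coincidences s x y. real (Suc n) \<le> dist c q) \<longrightarrow>
        b / 2 * real (Suc n) < a \<bullet> (c - t)"
      by (meson not_le)
    moreover have "0 < real (Suc n)" "0 < 1 / real (Suc n)" by simp_all
    ultimately show False using neg by blast
  qed
  then obtain x y s c t where E: "\<And>n. (x n, y n) \<in> E" and s: "\<And>n. norm (s n) < 1 / real (Suc n)"
    and t: "\<And>n. t n \<in> coincidences (s n) (x n) (y n)" and ct: "\<And>n. dist (c n) (t n) = real (Suc n)"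
    and hole: "\<And>n. \<forall>q\<in>coincidences (s n) (x n) (y n). real (Suc n) \<le> dist (c n) q"
    and bad: "\<And>n. a \<bullet> (c n - t n) \<le> b / 2 * real (Suc n)"
    by metis
  define w where "w n = (1 / real (Suc n)) *\<^sub>R (c n - t n)" for n
  have c: "c n = t n + real (Suc n) *\<^sub>R w n" for n
    by (simp add: w_def del: of_nat_Suc)
  have norm_w: "norm (w n) = 1" for n
    using ct[of n] by (simp add: w_def dist_norm del: of_nat_Suc)
  have "\<forall>n. w n \<in> cball 0 1" using norm_w by simp
  then obtain l r where r: "strict_mono r" "(w \<circ> r) \<longlonglongrightarrow> l"
    using compact_imp_seq_compact[OF compact_cball[of "0::'a" 1]] unfolding seq_compact_def by blast
  have inv0: "(\<lambda>n. 1 / real (Suc (r n))) \<longlonglongrightarrow> 0"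
    using LIMSEQ_subseq_LIMSEQ[OF LIMSEQ_Suc[OF lim_1_over_n] r(1)] by (simp add: o_def)
  have "l \<in> free_directions"
  proof (rule free_direction_limit)
    show "(translate (t (r n)) (x (r n)), translate (t (r n)) (y (r n))) \<in> E" for n
      using E by (rule translates)
    show "0 \<in> translate (t (r n)) (x (r n))" "s (r n) \<in> translate (t (r n)) (y (r n))" for n
      using t[of "r n"] by (simp_all add: add.commute)
    show "(\<lambda>n. s (r n)) \<longlonglongrightarrow> 0"
      using s by (intro Lim_null_comparison[OF _ inv0] always_eventually allI less_imp_le)
    show "(\<lambda>n. w (r n)) \<longlonglongrightarrow> l" using r(2) by (simp add: o_def)
    show "norm (w (r n)) = 1" for n by (rule norm_w)
    show "(\<lambda>n. 1 / real (Suc (r n)) * (1 / 2)) \<longlonglongrightarrow> 0"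
      using inv0 by (rule tendsto_mult_left_zero)
    fix n q
    let ?N = "real (Suc (r n))"
    assume "q \<in> coincidences (s (r n)) (translate (t (r n)) (x (r n))) (translate (t (r n)) (y (r n)))"
    then have "q + t (r n) \<in> coincidences (s (r n)) (x (r n)) (y (r n))" by (simp add: add_ac)
    then have "?N \<le> dist (c (r n)) (q + t (r n))" using hole by blast
    also have "\<dots> = norm (?N *\<^sub>R w (r n) - q)" by (simp add: c dist_norm del: of_nat_Suc)
    finally have "?N\<^sup>2 \<le> (norm (?N *\<^sub>R w (r n) - q))\<^sup>2" by (rule power_mono) simp
    also have "\<dots> = ?N\<^sup>2 * (norm (w (r n)))\<^sup>2 - 2 * ?N * (w (r n) \<bullet> q) + (norm q)\<^sup>2"
      unfolding power2_norm_eq_inner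
      by (simp add: inner_diff_left inner_diff_right inner_commute power2_eq_square del: of_nat_Suc)
    finally have "2 * ?N * (w (r n) \<bullet> q) \<le> (norm q)\<^sup>2" by (simp add: norm_w)
    then show "w (r n) \<bullet> q \<le> 1 / ?N * (1 / 2) * (norm q)\<^sup>2"
      by (simp add: field_simps del: of_nat_Suc)
  qed
  then have "b < a \<bullet> l" by (rule ab)
  moreover have "a \<bullet> l \<le> b / 2"
  proof (rule LIMSEQ_le_const2)
    show "(\<lambda>n. a \<bullet> w (r n)) \<longlonglongrightarrow> a \<bullet> l"
      using r(2) by (intro tendsto_intros) (simp add: o_def)
    have "a \<bullet> w (r n) \<le> b / 2" for n
      using bad[of "r n"] unfolding w_def inner_scaleR_right
      by (simp add: divide_le_eq del: of_nat_Suc)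
    then show "\<exists>N. \<forall>n\<ge>N. a \<bullet> w (r n) \<le> b / 2" by blast
  qed
  ultimately show False using \<open>0 < b\<close> by linarith
qed

text \<open>All contact directions lie in an open half-space \<open>{w. a \<bullet> w > 0}\<close>. So a ball that moves roughly in the
  direction of \<open>a\<close>, towards a coincidence ahead of it, cannot have started without coincidences:
  behind each coincidence there is a cone full of them.\<close>

lemma coincidences_dense_in_cone:
  obtains \<rho> \<sigma> \<delta> a where "0 < \<rho>" "0 < \<sigma>" "0 < \<delta>"
    "\<And>x y s t q k. \<lbrakk>(x, y) \<in> E; norm s < \<sigma>; t \<in> coincidences s x y; 0 \<le> k;
      dist q (t - k *\<^sub>R a) \<le> k * \<delta>\<rbrakk> \<Longrightarrow> \<exists>p\<in>coincidences s x y. dist q p \<le> \<rho>"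
proof -
  have "closed (convex hull free_directions)"
    by (intro compact_imp_closed compact_convex_hull compact_free_directions)
  then obtain a b where "0 < b" and ab: "\<forall>w\<in>convex hull free_directions. b < a \<bullet> w"
    using separating_hyperplane_closed_0[OF convex_convex_hull _ zero_notin_convex_hull_free_directions]
    by blast
  have ab: "b < a \<bullet> w" if "w \<in> free_directions" for w
    using ab hull_subset[of free_directions convex] that by blast
  obtain \<rho> \<sigma> where \<rho>\<sigma>: "\<rho> > 0" "\<sigma> > 0" and contact: "\<And>x y s c t. (x, y) \<in> E \<Longrightarrow> norm s < \<sigma> \<Longrightarrow>
      t \<in> coincidences s x y \<Longrightarrow> dist c t = \<rho> \<Longrightarrow> \<forall>q\<in>coincidences s x y. \<rho> \<le> dist c q \<Longrightarrow>
      b / 2 * \<rho> < a \<bullet> (c - t)"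
    using contact_directions[OF ab \<open>0 < b\<close>] by metis
  have "\<exists>p\<in>coincidences s x y. dist q p \<le> \<rho>"
    if xy: "(x, y) \<in> E" and s: "norm s < \<sigma>" and t: "t \<in> coincidences s x y" and k: "0 \<le> k"
      and q: "dist q (t - k *\<^sub>R a) \<le> k * (b / 2)" for x y s t q k
  proof (rule ccontr)
    assume "\<not> ?thesis"
    then have hole: "\<rho> < dist q p" if "p \<in> coincidences s x y" for p using that by force
    obtain c p where cp: "p \<in> coincidences s x y" "dist c p = \<rho>"
      "\<And>p'. p' \<in> coincidences s x y \<Longrightarrow> \<rho> \<le> dist c p'" "(t - q) \<bullet> (c - p) \<le> 0"
      using first_contact[OF closed_coincidences[OF xy] t hole \<rho>\<sigma>(1)] by blast
    have "b / 2 * \<rho> < a \<bullet> (c - p)" using contact[OF xy s cp(1,2)] cp(3) by blast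
    moreover have "k \<noteq> 0" using q hole[OF t] \<rho>\<sigma>(1) by auto
    ultimately have "k * (b / 2 * \<rho>) < k * (a \<bullet> (c - p))" using k by simp
    moreover define v where "v = q - (t - k *\<^sub>R a)"
    have "v \<bullet> (c - p) \<le> k * (b / 2) * \<rho>"
    proof -
      have "v \<bullet> (c - p) \<le> norm v * norm (c - p)" by (rule norm_cauchy_schwarz)
      also have "\<dots> \<le> k * (b / 2) * \<rho>"
        using q cp(2) \<rho>\<sigma>(1) by (intro mult_mono) (use k \<open>0 < b\<close> in \<open>auto simp: v_def dist_norm\<close>)
      finally show ?thesis .
    qed
    moreover have "(t - q) \<bullet> (c - p) = k * (a \<bullet> (c - p)) - v \<bullet> (c - p)"
      by (simp add: v_def inner_diff_left inner_add_left)
    ultimately show False using cp(4) by (simp add: mult.assoc)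
  qed
  then show thesis
    using that[OF \<rho>\<sigma>, of "b / 2" a] \<open>0 < b\<close> by simp
qed

text \<open>This excludes small nonzero shifts. The cone contains arbitrarily large balls, in
  which the almost coincidences are relatively dense. A limit yields a pair whose almost coincidences
  are relatively dense in the whole space. As they are no coincidences, the difference of this pair is
  relatively dense, too.\<close>

lemma small_shift_is_zero:
  "\<exists>\<sigma>>0. \<forall>x y q s. (x, y) \<in> E \<and> q \<in> coincidences s x y \<and> norm s < \<sigma> \<longrightarrow> s = 0"
proof -
  obtain \<rho> \<sigma> \<delta> a where pos: "0 < \<rho>" "0 < \<sigma>" "0 < \<delta>"
    and cone: "\<And>x y s t q k. \<lbrakk>(x, y) \<in> E; norm s < \<sigma>; t \<in> coincidences s x y; 0 \<le> k;
      dist q (t - k *\<^sub>R a) \<le> k * \<delta>\<rbrakk> \<Longrightarrow> \<exists>p\<in>coincidences s x y. dist q p \<le> \<rho>"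
    by (fact coincidences_dense_in_cone)
  obtain e where e: "e > 0" "\<forall>A\<in>delone_hull L. \<forall>p\<in>A. \<forall>q\<in>A. dist p q < e \<longrightarrow> p = q"
    using hull_uniformly_separated[OF delone] by blast
  have "s = 0" if xy: "(x, y) \<in> E" and t: "t \<in> coincidences s x y" and s: "norm s < min \<sigma> e" for x y t s
  proof (rule ccontr)
    assume "s \<noteq> 0"
    define c where "c n = t - real n *\<^sub>R a" for n
    have near: "\<exists>p\<in>coincidences s x y. dist q p \<le> \<rho>" if "dist q (c n) \<le> real n * \<delta>" for q n
      using cone[OF xy _ t _ that[unfolded c_def]] s by simp
    have "\<exists>p\<in>coincidences s x y. dist (c n) p \<le> \<rho>" for n
      using pos by (intro near[of _ n]) simp
    then obtain p where p: "\<And>n. p n \<in> coincidences s x y" "\<And>n. dist (c n) (p n) \<le> \<rho>" by metis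
    obtain r x' y' u where r: "strict_mono r" "(x', y') \<in> E" "((\<lambda>n. s) \<circ> r) \<longlonglongrightarrow> u"
      "locally_tends ((\<lambda>n. coincidences s (translate (p n) x) (translate (p n) y)) \<circ> r) (coincidences u x' y')"
    proof (rule limit_pair)
      show "(translate (p n) x, translate (p n) y) \<in> E" for n using xy by (rule translates)
      show "0 \<in> translate (p n) x" "s \<in> translate (p n) y" for n
        using p(1)[of n] by (auto simp: add.commute)
      show "norm s \<le> norm s" for n :: nat by simp
    qed (rule that; assumption)
    have u: "u = s" using r(3) by (simp add: o_def LIMSEQ_const_iff)
    have "\<exists>z\<in>(x' - y') \<union> (y' - x'). dist q z \<le> \<rho> + norm s" for q
    proof -
      obtain n where n: "\<And>v. norm v \<le> norm q + \<rho> \<Longrightarrow>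
          v \<in> coincidences s (translate (p (r n)) x) (translate (p (r n)) y) \<longleftrightarrow> v \<in> coincidences s x' y'"
        and large: "norm q + \<rho> \<le> real n * \<delta>"
      proof -
        obtain N where "(norm q + \<rho>) / \<delta> \<le> real N" using real_arch_simple by blast
        then have "norm q + \<rho> \<le> real n * \<delta>" if "n \<ge> N" for n
        proof -
          have "(norm q + \<rho>) / \<delta> \<le> real n" using \<open>_ \<le> real N\<close> that by linarith
          then show ?thesis using pos by (simp add: divide_le_eq)
        qed
        moreover obtain M where "\<forall>n\<ge>M. \<forall>v. norm v \<le> norm q + \<rho> \<longrightarrow>
          (v \<in> coincidences s (translate (p (r n)) x) (translate (p (r n)) y) \<longleftrightarrow> v \<in> coincidences s x' y')"
          using locally_tendsD[OF r(4), of "norm q + \<rho>"] u by (auto simp: eventually_sequentially)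
        ultimately show thesis using that[of "max M N"] by simp
      qed
      have "dist (q + p (r n)) (c (r n)) \<le> norm q + \<rho>"
        using p(2)[of "r n"] norm_triangle_ineq[of q "p (r n) - c (r n)"]
        by (simp add: dist_norm norm_minus_commute algebra_simps)
      also have "\<dots> \<le> real (r n) * \<delta>"
      proof -
        have "real n * \<delta> \<le> real (r n) * \<delta>"
          using seq_suble[OF r(1), of n] pos by (intro mult_right_mono) auto
        with large show ?thesis by linarith
      qed
      finally obtain z where z: "z \<in> coincidences s x y" "dist (q + p (r n)) z \<le> \<rho>"
        using near by blast
      define v where "v = z - p (r n)"
      have qv: "dist q v \<le> \<rho>" using z(2) by (simp add: v_def dist_norm algebra_simps)
      then have "norm v \<le> norm q + \<rho>"
        using norm_triangle_ineq[of q "v - q"] by (simp add: dist_norm norm_minus_commute)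
      moreover have "v \<in> coincidences s (translate (p (r n)) x) (translate (p (r n)) y)"
        using z(1) by (simp add: v_def algebra_simps)
      ultimately have v: "v \<in> x'" "v + s \<in> y'" using n by auto
      have "v + s \<notin> x'"
      proof
        assume "v + s \<in> x'"
        moreover have "x' \<in> delone_hull L" using r(2) hull by blast
        moreover have "dist v (v + s) < e" using s by (simp add: dist_norm)
        ultimately have "v = v + s" using e(2) v(1) by blast
        with \<open>s \<noteq> 0\<close> show False by simp
      qed
      moreover have "dist q (v + s) \<le> \<rho> + norm s"
        using qv dist_triangle[of q "v + s" v] by (simp add: dist_norm)
      ultimately show ?thesis using v(2) by blast
    qed
    then show False
      using difference_not_relatively_dense[OF r(2), of "\<rho> + norm s"] by (meson not_le)
  qed
  then show ?thesis
    using pos(2) e(1) by (intro exI[of _ "min \<sigma> e"]) auto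
qed

text \<open>In the limit of ever larger balls without \<open>R\<close>-agreement, strong proximality provides an agreement. It was
  an agreement up to a small shift before the limit, and the shift must have been zero.\<close>

lemma strongly_syndetically_proximal:
  assumes xy: "(x, y) \<in> E"
  shows "relatively_dense {t. central_patch R (translate t x) = central_patch R (translate t y)}"
proof (rule ccontr)
  assume neg: "\<not> ?thesis"
  obtain R0 where R0: "R0 > 0" "\<forall>A\<in>delone_hull L. \<forall>p. \<exists>q\<in>A. dist p q \<le> R0"
    using hull_uniformly_dense[OF delone] by blast
  obtain \<sigma> where \<sigma>: "\<sigma> > 0" "\<And>x y q s. (x, y) \<in> E \<Longrightarrow> q \<in> coincidences s x y \<Longrightarrow> norm s < \<sigma> \<Longrightarrow> s = 0"
    using small_shift_is_zero by blast
  have hullxy: "x \<in> delone_hull L" "y \<in> delone_hull L" using xy hull by blast+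
  \<comment> \<open>the centres of the balls are moved to points of \<open>x\<close>, so that limits can be taken\<close>
  have "\<exists>c\<in>x. \<forall>t. central_patch R (translate t x) = central_patch R (translate t y) \<longrightarrow> real n < dist c t" for n
  proof -
    obtain p where p: "\<And>t. central_patch R (translate t x) = central_patch R (translate t y) \<Longrightarrow>
        real n + R0 < dist p t"
      using neg unfolding relatively_dense_def by (metis (mono_tags) mem_Collect_eq not_le)
    obtain c where "c \<in> x" "dist p c \<le> R0" using R0(2) hullxy by blast
    moreover have "real n < dist c t"
      if "central_patch R (translate t x) = central_patch R (translate t y)" for t
      using p[OF that] dist_triangle[of p t c] \<open>dist p c \<le> R0\<close> by linarith
    ultimately show ?thesis by blast
  qed
  then obtain c where c: "\<And>n. c n \<in> x"
    "\<And>n t. central_patch R (translate t x) = central_patch R (translate t y) \<Longrightarrow> real n < dist (c n) t"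
    by metis
  have "\<exists>s. c n + s \<in> y \<and> norm s \<le> R0" for n
  proof -
    obtain q where "q \<in> y" "dist (c n) q \<le> R0" using R0(2) hullxy by blast
    then show ?thesis by (intro exI[of _ "q - c n"]) (simp add: dist_norm norm_minus_commute)
  qed
  then obtain s where s: "\<And>n. c n + s n \<in> y" "\<And>n. norm (s n) \<le> R0" by metis
  define X Y where "X n = translate (c n) x" and "Y n = translate (c n) y" for n
  obtain r x' y' u where r: "strict_mono r" "(x', y') \<in> E" "(s \<circ> r) \<longlonglongrightarrow> u"
    "locally_tends (X \<circ> r) x'" "locally_tends ((\<lambda>n. translate (s n) (Y n)) \<circ> r) (translate u y')"
  proof (rule limit_pair)
    show "(X n, Y n) \<in> E" for n unfolding X_def Y_def using xy by (rule translates)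
    show "0 \<in> X n" "s n \<in> Y n" "norm (s n) \<le> R0" for n
      using c(1) s by (simp_all add: X_def Y_def add.commute)
  qed (rule that; assumption)
  define R' where "R' = max R R0"
  obtain t where t: "central_patch R' (translate t x') = central_patch R' (translate t y')"
    using strongly_proximal[OF r(2)] by blast
  have t: "v + t \<in> x' \<longleftrightarrow> v + t \<in> y'" if "norm v \<le> R'" for v
  proof -
    have "v \<in> central_patch R' (translate t x') \<longleftrightarrow> v \<in> central_patch R' (translate t y')" using t by simp
    then show ?thesis using that by simp
  qed
  have "x' \<in> delone_hull L" using r(2) hull by blast
  then obtain q where q: "q \<in> x'" "dist t q \<le> R0" using R0(2) by blast
  have "q \<in> y'" using t[of "q - t"] q by (simp add: R'_def dist_norm norm_minus_commute)
  define B where "B = norm t + R' + norm q + norm u"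
  have "\<forall>\<^sub>F n in sequentially. dist (s (r n)) u < \<sigma>"
    using tendstoD[OF r(3) \<sigma>(1)] by (simp add: o_def)
  with locally_tendsD[OF r(4), of B] locally_tendsD[OF r(5), of B]
  have "\<forall>\<^sub>F n in sequentially. norm t < real n \<and> dist (s (r n)) u < \<sigma> \<and>
      (\<forall>v. norm v \<le> B \<longrightarrow> (v \<in> X (r n) \<longleftrightarrow> v \<in> x')) \<and>
      (\<forall>v. norm v \<le> B \<longrightarrow> (v + s (r n) \<in> Y (r n) \<longleftrightarrow> v + u \<in> y'))"
    using filterlim_real_sequentially[THEN filterlim_at_top_dense[THEN iffD1], rule_format, of "norm t"]
    by eventually_elim simp
  then obtain n where n: "norm t < real n" "dist (s (r n)) u < \<sigma>"
      "\<And>v. norm v \<le> B \<Longrightarrow> v \<in> X (r n) \<longleftrightarrow> v \<in> x'"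
      "\<And>v. norm v \<le> B \<Longrightarrow> v + s (r n) \<in> Y (r n) \<longleftrightarrow> v + u \<in> y'"
    using eventually_happens'[OF sequentially_bot] by blast
  have R': "0 \<le> R'" using R0(1) by (simp add: R'_def)
  \<comment> \<open>the common point \<open>q\<close> of the limit pair comes from an almost coincidence of the \<open>n\<close>-th pair\<close>
  have "q \<in> X (r n)" using n(3)[of q] q(1) R' by (simp add: B_def)
  moreover have "q + (s (r n) - u) \<in> Y (r n)"
    using n(4)[of "q - u"] \<open>q \<in> y'\<close> R' norm_triangle_ineq4[of q u] norm_ge_zero[of t]
    by (simp add: B_def algebra_simps)
  moreover have "(X (r n), Y (r n)) \<in> E" unfolding X_def Y_def using xy by (rule translates)
  moreover have "norm (s (r n) - u) < \<sigma>" using n(2) by (simp add: dist_norm)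
  ultimately have su: "s (r n) = u" using \<sigma>(2)[of "X (r n)" "Y (r n)" q "s (r n) - u"] by simp
  have "v + t \<in> X (r n) \<longleftrightarrow> v + t \<in> Y (r n)" if "norm v \<le> R" for v
  proof -
    have "norm (v + t) \<le> B"
      using that norm_triangle_ineq[of v t] norm_ge_zero[of q] norm_ge_zero[of u]
      unfolding B_def R'_def by linarith
    then have "v + t \<in> X (r n) \<longleftrightarrow> v + t \<in> x'" by (rule n(3))
    also have "\<dots> \<longleftrightarrow> v + t \<in> y'" using that by (intro t) (simp add: R'_def)
    also have "\<dots> \<longleftrightarrow> v + t \<in> Y (r n)"
    proof -
      have "norm (v + t - u) \<le> B"
        using that norm_triangle_ineq[of v t] norm_triangle_ineq4[of "v + t" u] norm_ge_zero[of q]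
        unfolding B_def R'_def by linarith
      then show ?thesis using n(4)[of "v + t - u"] su by simp
    qed
    finally show ?thesis .
  qed
  then have "central_patch R (translate (t + c (r n)) x) = central_patch R (translate (t + c (r n)) y)"
    by (intro set_eqI) (auto simp: X_def Y_def add_ac)
  then have "real (r n) < dist (c (r n)) (t + c (r n))" by (rule c(2))
  then have "real (r n) < norm t" by (simp add: dist_norm)
  moreover have "real n \<le> real (r n)" using seq_suble[OF r(1), of n] by simp
  ultimately show False using n(1) by linarith
qed

end

section \<open>Relations on the hull and equicontinuous factors\<close>

lemma topspace_hull_topology [simp]: "topspace (hull_topology L) = delone_hull L"
  unfolding hull_topology_def by (simp add: Metric_space.topspace_mtopology[OF Metric_space_delone_hull])

lemma limitin_hull_topology:
  assumes "\<And>n. X n \<in> delone_hull L" "x \<in> delone_hull L" "(\<lambda>n. delone_dist (X n) x) \<longlonglongrightarrow> 0"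
  shows "limitin (hull_topology L) X x sequentially"
  unfolding hull_topology_def Metric_space.limitin_metric_dist_null[OF Metric_space_delone_hull]
  using assms by simp

lemma factor_limit:
  assumes "factor_map (hull_topology L) translate Y \<beta> \<pi>"
    and "Metric_space (topspace Y) d" "Metric_space.mtopology (topspace Y) d = Y"
    and "\<And>n. X n \<in> delone_hull L" "x \<in> delone_hull L" "(\<lambda>n. delone_dist (X n) x) \<longlonglongrightarrow> 0"
  shows "(\<lambda>n. d (\<pi> (X n)) (\<pi> x)) \<longlonglongrightarrow> 0"
proof -
  have "continuous_map (hull_topology L) Y \<pi>" using assms(1) by (simp add: factor_map_def)
  then have "limitin Y (\<pi> \<circ> X) (\<pi> x) sequentially"
    using limitin_hull_topology[OF assms(4-6)] by (rule continuous_map_limit)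
  then have "limitin (Metric_space.mtopology (topspace Y) d) (\<pi> \<circ> X) (\<pi> x) sequentially"
    by (simp add: assms(3))
  then show ?thesis
    by (simp add: Metric_space.limitin_metric_dist_null[OF assms(2)] o_def)
qed

lemma factor_in_topspace:
  assumes "factor_map (hull_topology L) translate Y \<beta> \<pi>" "x \<in> delone_hull L"
  shows "\<pi> x \<in> topspace Y"
  using assms by (auto simp: factor_map_def)

lemma factor_equivariant:
  assumes "factor_map (hull_topology L) translate Y \<beta> \<pi>" "x \<in> delone_hull L"
  shows "\<pi> (translate t x) = \<beta> t (\<pi> x)"
  using assms by (simp add: factor_map_def)

lemma equicontinuous_structure_rel_translate:
  assumes "factor_map (hull_topology L) translate Y \<beta> \<pi>" "(x, y) \<in> equicontinuous_structure_rel L \<pi>"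
  shows "(translate t x, translate t y) \<in> equicontinuous_structure_rel L \<pi>"
  using assms translate_in_delone_hull
  by (auto simp: equicontinuous_structure_rel_def factor_map_def)

lemma equicontinuous_structure_rel_limit:
  assumes "factor_map (hull_topology L) translate Y \<beta> \<pi>" "equicontinuous_system Y \<beta>"
    and "\<And>n. (X n, Z n) \<in> equicontinuous_structure_rel L \<pi>" "x \<in> delone_hull L" "z \<in> delone_hull L"
    and "(\<lambda>n. delone_dist (X n) x) \<longlonglongrightarrow> 0" "(\<lambda>n. delone_dist (Z n) z) \<longlonglongrightarrow> 0"
  shows "(x, z) \<in> equicontinuous_structure_rel L \<pi>"
proof -
  have XZ: "X n \<in> delone_hull L" "Z n \<in> delone_hull L" "\<pi> (X n) = \<pi> (Z n)" for n
    using assms(3)[of n] by (auto simp: equicontinuous_structure_rel_def)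
  have "continuous_map (hull_topology L) Y \<pi>" using assms(1) by (simp add: factor_map_def)
  then have "limitin Y (\<pi> \<circ> X) (\<pi> x) sequentially" "limitin Y (\<pi> \<circ> Z) (\<pi> z) sequentially"
    using XZ assms by (auto intro!: continuous_map_limit limitin_hull_topology)
  moreover have "\<pi> \<circ> X = \<pi> \<circ> Z" using XZ(3) by auto
  moreover have "Hausdorff_space Y"
    using assms(2) by (simp add: equicontinuous_system_def dynamical_system_def)
  ultimately have "\<pi> x = \<pi> z"
    using limitin_Hausdorff_unique[of Y "\<pi> \<circ> X" "\<pi> x" sequentially "\<pi> z"] by simp
  with assms(4,5) show ?thesis by (simp add: equicontinuous_structure_rel_def)
qed

lemma factor_uniformly_continuous:
  assumes "delone L" "finite_local_complexity L" "factor_map (hull_topology L) translate Y \<beta> \<pi>"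
    and d: "Metric_space (topspace Y) d" "Metric_space.mtopology (topspace Y) d = Y" and "0 < (e::real)"
  obtains \<delta> where "0 < \<delta>"
    "\<And>x y. \<lbrakk>x \<in> delone_hull L; y \<in> delone_hull L; delone_dist x y < \<delta>\<rbrakk> \<Longrightarrow> d (\<pi> x) (\<pi> y) < e"
proof (rule ccontr)
  assume no: "\<not> thesis"
  interpret d: Metric_space "topspace Y" d by fact
  have "\<exists>x y. x \<in> delone_hull L \<and> y \<in> delone_hull L \<and> delone_dist x y < 1 / real (Suc n) \<and> e \<le> d (\<pi> x) (\<pi> y)" for n
    using no that[of "1 / real (Suc n)"] by (meson not_le of_nat_0_less_iff zero_less_Suc zero_less_divide_1_iff)
  then obtain X Z where XZ: "\<And>n. X n \<in> delone_hull L" "\<And>n. Z n \<in> delone_hull L"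
    "\<And>n. delone_dist (X n) (Z n) < 1 / real (Suc n)" "\<And>n. e \<le> d (\<pi> (X n)) (\<pi> (Z n))"
    by metis
  obtain r x where r: "strict_mono r" "x \<in> delone_hull L" "(\<lambda>n. delone_dist (X (r n)) x) \<longlonglongrightarrow> 0"
    by (rule hull_sequentially_compact[OF assms(1,2) XZ(1)])
  have "(\<lambda>n. 1 / real (Suc (r n))) \<longlonglongrightarrow> 0"
    using LIMSEQ_subseq_LIMSEQ[OF LIMSEQ_Suc[OF lim_1_over_n] r(1)] by (simp add: o_def)
  from tendsto_add[OF this r(3)]
  have lim: "(\<lambda>n. 1 / real (Suc (r n)) + delone_dist (X (r n)) x) \<longlonglongrightarrow> 0" by simp
  have "delone_dist (Z (r n)) x \<le> 1 / real (Suc (r n)) + delone_dist (X (r n)) x" for n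
    using delone_dist_triangle[of "Z (r n)" x "X (r n)"] XZ(3)[of "r n"]
    by (simp add: delone_dist_commute[of "Z (r n)"] del: of_nat_Suc)
  then have "norm (delone_dist (Z (r n)) x) \<le> 1 / real (Suc (r n)) + delone_dist (X (r n)) x" for n
    by (simp add: delone_dist_nonneg del: of_nat_Suc)
  then have "(\<lambda>n. delone_dist (Z (r n)) x) \<longlonglongrightarrow> 0"
    by (intro Lim_null_comparison[OF _ lim] always_eventually allI)
  from tendsto_add[OF factor_limit[OF assms(3) d XZ(1) r(2,3)] factor_limit[OF assms(3) d XZ(2) r(2) this]]
  have "(\<lambda>n. d (\<pi> (X (r n))) (\<pi> x) + d (\<pi> (Z (r n))) (\<pi> x)) \<longlonglongrightarrow> 0" by simp
  moreover have "e \<le> d (\<pi> (X (r n))) (\<pi> x) + d (\<pi> (Z (r n))) (\<pi> x)" for n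
    using XZ(4)[of "r n"] d.triangle[of "\<pi> (X (r n))" "\<pi> x" "\<pi> (Z (r n))"]
      factor_in_topspace[OF assms(3)] XZ(1,2) r(2) by (simp add: d.commute)
  ultimately show False
    using \<open>0 < e\<close> LIMSEQ_le_const[of _ 0 e] by force
qed

lemma regional_proximal_rel_witness:
  assumes "(x, y) \<in> regional_proximal_rel L" "0 < \<epsilon>" "0 < \<delta>"
  obtains x' y' t where "x' \<in> delone_hull L" "y' \<in> delone_hull L" "delone_dist x x' < \<delta>" "delone_dist y y' < \<delta>"
    "delone_dist (translate t x') (translate t y') < \<epsilon>"
proof -
  interpret Metric_space "delone_hull L" delone_dist by (rule Metric_space_delone_hull)
  have cl: "(x, y) \<in> prod_topology (hull_topology L) (hull_topology L) closure_of proximal_eps L \<epsilon>"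
    using assms(1,2) by (auto simp: regional_proximal_rel_def)
  then have xy: "x \<in> delone_hull L" "y \<in> delone_hull L"
    by (auto simp: in_closure_of)
  have "openin (prod_topology (hull_topology L) (hull_topology L)) (mball x \<delta> \<times> mball y \<delta>)"
    unfolding hull_topology_def by (simp add: openin_prod_Times_iff)
  moreover have "(x, y) \<in> mball x \<delta> \<times> mball y \<delta>" using xy assms(3) by simp
  ultimately have "\<exists>z. z \<in> proximal_eps L \<epsilon> \<and> z \<in> mball x \<delta> \<times> mball y \<delta>"
    using cl[unfolded in_closure_of] by (meson conjI)
  then obtain x' y' where "(x', y') \<in> proximal_eps L \<epsilon>" "x' \<in> mball x \<delta>" "y' \<in> mball y \<delta>" by auto
  then show thesis using that[of x' y'] by (auto simp: proximal_eps_def)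
qed

lemma regional_proximal_relI:
  assumes xy: "x \<in> delone_hull L" "y \<in> delone_hull L"
    and near: "\<And>\<epsilon>. 0 < \<epsilon> \<Longrightarrow> \<exists>x'\<in>delone_hull L. \<exists>y'\<in>delone_hull L. \<exists>t.
      delone_dist x x' < \<epsilon> \<and> delone_dist y y' < \<epsilon> \<and> delone_dist (translate t x') (translate t y') < \<epsilon>"
  shows "(x, y) \<in> regional_proximal_rel L"
  unfolding regional_proximal_rel_def
proof
  interpret Metric_space "delone_hull L" delone_dist by (rule Metric_space_delone_hull)
  fix \<epsilon> :: real assume "\<epsilon> \<in> {0<..}"
  then have \<epsilon>: "0 < \<epsilon>" by simp
  show "(x, y) \<in> prod_topology (hull_topology L) (hull_topology L) closure_of proximal_eps L \<epsilon>"
    unfolding in_closure_of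
  proof (intro conjI allI impI; (elim conjE)?)
    show "(x, y) \<in> topspace (prod_topology (hull_topology L) (hull_topology L))" using xy by simp
    fix T assume "(x, y) \<in> T" "openin (prod_topology (hull_topology L) (hull_topology L)) T"
    then have "\<exists>U V. openin mtopology U \<and> openin mtopology V \<and> x \<in> U \<and> y \<in> V \<and> U \<times> V \<subseteq> T"
      by (simp only: openin_prod_topology_alt hull_topology_def)
    then obtain U V where UV: "openin mtopology U" "openin mtopology V" "x \<in> U" "y \<in> V" "U \<times> V \<subseteq> T"
      by (elim exE conjE)
    obtain r1 where r1: "r1 > 0" "mball x r1 \<subseteq> U" using UV unfolding openin_mtopology by blast
    obtain r2 where r2: "r2 > 0" "mball y r2 \<subseteq> V" using UV unfolding openin_mtopology by blast
    obtain x' y' t where *: "x' \<in> delone_hull L" "y' \<in> delone_hull L" "delone_dist x x' < min \<epsilon> (min r1 r2)"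
      "delone_dist y y' < min \<epsilon> (min r1 r2)" "delone_dist (translate t x') (translate t y') < min \<epsilon> (min r1 r2)"
      using near[of "min \<epsilon> (min r1 r2)"] \<epsilon> r1(1) r2(1) by auto
    have "x' \<in> U" "y' \<in> V" using * r1(2) r2(2) xy by auto
    moreover have "(x', y') \<in> proximal_eps L \<epsilon>" using * by (auto simp: proximal_eps_def)
    ultimately show "\<exists>z. z \<in> proximal_eps L \<epsilon> \<and> z \<in> T" using UV(5) by blast
  qed
qed

text \<open>If translates by \<open>t\<close> of nearby sets are close, then so are their images in the factor, and by equicontinuity
  the translation by \<open>- t\<close> keeps these images close.\<close>

lemma regional_proximal_imp_equicontinuous_structure:
  assumes L: "delone L" "finite_local_complexity L"
    and fac: "factor_map (hull_topology L) translate Y \<beta> \<pi>" and eq: "equicontinuous_system Y \<beta>"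
  shows "regional_proximal_rel L \<subseteq> equicontinuous_structure_rel L \<pi>"
proof (rule subrelI)
  fix x y assume xy: "(x, y) \<in> regional_proximal_rel L"
  have "(x, y) \<in> prod_topology (hull_topology L) (hull_topology L) closure_of proximal_eps L 1"
    using xy unfolding regional_proximal_rel_def by (rule INT_D) simp
  then have "(x, y) \<in> topspace (prod_topology (hull_topology L) (hull_topology L))"
    unfolding in_closure_of by blast
  then have xyL: "x \<in> delone_hull L" "y \<in> delone_hull L" by simp_all
  obtain d where d: "Metric_space (topspace Y) d" "Metric_space.mtopology (topspace Y) d = Y"
    and equi: "\<And>\<epsilon>. \<epsilon> > 0 \<Longrightarrow> \<exists>\<delta>>0. \<forall>x\<in>topspace Y. \<forall>y\<in>topspace Y. d x y < \<delta> \<longrightarrow> (\<forall>t. d (\<beta> t x) (\<beta> t y) < \<epsilon>)"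
    using eq unfolding equicontinuous_system_def by blast
  interpret d: Metric_space "topspace Y" d by fact
  note top = factor_in_topspace[OF fac]
  have "d (\<pi> x) (\<pi> y) \<le> 0 + e" if "e > 0" for e
  proof -
    from that have e3: "e / 3 > 0" by simp
    obtain \<eta> where \<eta>: "\<eta> > 0" "\<And>p q t. \<lbrakk>p \<in> topspace Y; q \<in> topspace Y; d p q < \<eta>\<rbrakk> \<Longrightarrow> d (\<beta> t p) (\<beta> t q) < e / 3"
      using equi[OF e3] by blast
    obtain \<epsilon> where \<epsilon>: "\<epsilon> > 0" "\<And>x y. \<lbrakk>x \<in> delone_hull L; y \<in> delone_hull L; delone_dist x y < \<epsilon>\<rbrakk> \<Longrightarrow> d (\<pi> x) (\<pi> y) < \<eta>"
      by (rule factor_uniformly_continuous[OF L fac d \<eta>(1)]) blast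
    obtain \<delta> where \<delta>: "\<delta> > 0" "\<And>x y. \<lbrakk>x \<in> delone_hull L; y \<in> delone_hull L; delone_dist x y < \<delta>\<rbrakk> \<Longrightarrow> d (\<pi> x) (\<pi> y) < e / 3"
      by (rule factor_uniformly_continuous[OF L fac d e3]) blast
    obtain x' y' t where w: "x' \<in> delone_hull L" "y' \<in> delone_hull L" "delone_dist x x' < \<delta>" "delone_dist y y' < \<delta>"
      "delone_dist (translate t x') (translate t y') < \<epsilon>"
      using regional_proximal_rel_witness[OF xy \<epsilon>(1) \<delta>(1)] by blast
    have retract: "\<pi> z = \<beta> (- t) (\<pi> (translate t z))" if "z \<in> delone_hull L" for z
      using factor_equivariant[OF fac translate_in_delone_hull[OF that], of "- t" t] by simp
    have "d (\<pi> (translate t x')) (\<pi> (translate t y')) < \<eta>"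
      using w by (intro \<epsilon>(2) translate_in_delone_hull)
    then have "d (\<pi> x') (\<pi> y') < e / 3"
      unfolding retract[OF w(1)] retract[OF w(2)] using w by (intro \<eta>(2) top translate_in_delone_hull)
    moreover have "d (\<pi> x) (\<pi> x') < e / 3" "d (\<pi> y) (\<pi> y') < e / 3"
      using w xyL by (blast intro: \<delta>(2))+
    moreover have "d (\<pi> x) (\<pi> y) \<le> d (\<pi> x) (\<pi> x') + d (\<pi> x') (\<pi> y') + d (\<pi> y) (\<pi> y')"
      using d.triangle[of "\<pi> x" "\<pi> x'" "\<pi> y"] d.triangle[of "\<pi> x'" "\<pi> y'" "\<pi> y"] top xyL w
      by (simp add: d.commute)
    ultimately show ?thesis by simp
  qed
  then have "d (\<pi> x) (\<pi> y) \<le> 0" by (rule field_le_epsilon)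
  then have "\<pi> x = \<pi> y" using d.zero[of "\<pi> x" "\<pi> y"] d.nonneg[of "\<pi> x" "\<pi> y"] top xyL by simp
  then show "(x, y) \<in> equicontinuous_structure_rel L \<pi>"
    using xyL by (simp add: equicontinuous_structure_rel_def)
qed

lemma central_patch_eq_imp_delone_dist_less:
  assumes "0 < \<epsilon>" "central_patch (1 / \<epsilon>) A = central_patch (1 / \<epsilon>) B"
  shows "delone_dist A B < \<epsilon>"
proof -
  have "delone_dist A B \<le> \<epsilon> / (\<epsilon> + 1)"
    using assms by (intro delone_dist_le[of \<epsilon> 0 0]) auto
  also have "\<dots> < \<epsilon>" using assms(1) by (simp add: field_simps)
  finally show ?thesis .
qed

lemma relatively_dense_mono: "relatively_dense A \<Longrightarrow> A \<subseteq> B \<Longrightarrow> relatively_dense B"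
  unfolding relatively_dense_def by blast

lemma strong_syndetic_imp_strong_proximal: "strong_syndetic_proximal_rel L \<subseteq> strong_proximal_rel L"
  unfolding strong_syndetic_proximal_rel_def strong_proximal_rel_def relatively_dense_def by blast

lemma strong_syndetic_imp_syndetic_proximal: "strong_syndetic_proximal_rel L \<subseteq> syndetic_proximal_rel L"
proof (rule subrelI)
  fix x y assume xy: "(x, y) \<in> strong_syndetic_proximal_rel L"
  have "relatively_dense {t. delone_dist (translate t x) (translate t y) < \<epsilon>}" if "0 < \<epsilon>" for \<epsilon> :: real
  proof (rule relatively_dense_mono)
    show "relatively_dense {t. central_patch (1 / \<epsilon>) (translate t x) = central_patch (1 / \<epsilon>) (translate t y)}"
      using xy that unfolding strong_syndetic_proximal_rel_def by simp
  qed (use central_patch_eq_imp_delone_dist_less[OF that] in blast)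
  with xy show "(x, y) \<in> syndetic_proximal_rel L"
    by (simp add: syndetic_proximal_rel_def strong_syndetic_proximal_rel_def)
qed

lemma syndetic_imp_proximal: "syndetic_proximal_rel L \<subseteq> proximal_rel L"
proof (rule subrelI)
  fix x y assume xy: "(x, y) \<in> syndetic_proximal_rel L"
  have "\<exists>t. delone_dist (translate t x) (translate t y) < \<epsilon>" if "0 < \<epsilon>" for \<epsilon> :: real
    using xy that unfolding syndetic_proximal_rel_def relatively_dense_def by blast
  with xy show "(x, y) \<in> proximal_rel L"
    by (simp add: proximal_rel_def proximal_eps_def syndetic_proximal_rel_def)
qed

lemma proximal_imp_regional_proximal: "proximal_rel L \<subseteq> regional_proximal_rel L"
proof -
  have "proximal_eps L \<epsilon> \<subseteq> prod_topology (hull_topology L) (hull_topology L) closure_of proximal_eps L \<epsilon>" for \<epsilon>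
    by (rule closure_of_subset) (auto simp: proximal_eps_def)
  then show ?thesis
    unfolding proximal_rel_def regional_proximal_rel_def by blast
qed

lemma strong_proximal_imp_strong_regional_proximal:
  "strong_proximal_rel L \<subseteq> strong_regional_proximal_rel L"
  unfolding strong_proximal_rel_def strong_regional_proximal_rel_def by blast

lemma strong_regional_proximal_imp_regional_proximal:
  "strong_regional_proximal_rel L \<subseteq> regional_proximal_rel L"
proof (rule subrelI)
  fix x y assume xy: "(x, y) \<in> strong_regional_proximal_rel L"
  show "(x, y) \<in> regional_proximal_rel L"
  proof (rule regional_proximal_relI)
    show "x \<in> delone_hull L" "y \<in> delone_hull L"
      using xy by (auto simp: strong_regional_proximal_rel_def)
    fix \<epsilon> :: real assume \<epsilon>: "0 < \<epsilon>"
    then obtain x' y' t where w: "x' \<in> delone_hull L" "y' \<in> delone_hull L"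
      "central_patch (1 / \<epsilon>) x = central_patch (1 / \<epsilon>) x'" "central_patch (1 / \<epsilon>) y = central_patch (1 / \<epsilon>) y'"
      "central_patch (1 / \<epsilon>) (translate t x') = central_patch (1 / \<epsilon>) (translate t y')"
      using xy unfolding strong_regional_proximal_rel_def by (auto dest!: spec[of _ "1 / \<epsilon>"])
    then show "\<exists>x'\<in>delone_hull L. \<exists>y'\<in>delone_hull L. \<exists>t.
      delone_dist x x' < \<epsilon> \<and> delone_dist y y' < \<epsilon> \<and> delone_dist (translate t x') (translate t y') < \<epsilon>"
      using central_patch_eq_imp_delone_dist_less[OF \<epsilon>] by blast
  qed
qed

lemma coincidence_rank_eq_1:
  assumes "proximal_rel L = equicontinuous_structure_rel L \<pi>" "x \<in> delone_hull L" "\<pi> x = \<xi>"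
  shows "coincidence_rank L \<pi> \<xi> = 1"
proof -
  let ?A = "{enat l |l. \<exists>x :: nat \<Rightarrow> 'a set. (\<forall>i<l. x i \<in> delone_hull L \<and> \<pi> (x i) = \<xi>) \<and>
      (\<forall>i<l. \<forall>j<l. i \<noteq> j \<longrightarrow> (x i, x j) \<notin> proximal_rel L)}"
  have "Sup ?A \<le> 1"
  proof (rule Sup_least)
    fix k assume "k \<in> ?A"
    then obtain l X where k: "k = enat l" and X: "\<forall>i<l. X i \<in> delone_hull L \<and> \<pi> (X i) = \<xi>"
      "\<forall>i<l. \<forall>j<l. i \<noteq> j \<longrightarrow> (X i, X j) \<notin> proximal_rel L" by blast
    have "\<not> 1 < l"
    proof
      assume "1 < l"
      then have "(X 0, X 1) \<notin> proximal_rel L" using X(2) by simp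
      moreover have "(X 0, X 1) \<in> equicontinuous_structure_rel L \<pi>"
        using X(1) \<open>1 < l\<close> by (simp add: equicontinuous_structure_rel_def)
      ultimately show False using assms(1) by simp
    qed
    then show "k \<le> 1" by (simp add: k one_enat_def)
  qed
  moreover have "enat 1 \<in> ?A"
    using assms(2,3) by (intro CollectI exI[of _ 1] exI[of _ "\<lambda>_. x"] conjI) auto
  then have "1 \<le> Sup ?A" unfolding one_enat_def by (rule Sup_upper)
  ultimately show ?thesis
    unfolding coincidence_rank_def by (rule antisym)
qed


section \<open>Agreement of the relations\<close>

theorem corollary4p14:
  fixes L :: "(real ^ 'n) set"
    and \<Lambda> :: "nat \<Rightarrow> (real ^ 'n) set"
    and \<Omega>max :: "'b topology"
    and \<beta> :: "real ^ 'n \<Rightarrow> 'b \<Rightarrow> 'b"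
    and \<pi>max :: "(real ^ 'n) set \<Rightarrow> 'b"
  assumes "delone L" and "finite_local_complexity L" and "repetitive L"
    and "van_hove \<Lambda>"
    and "maximal_equicontinuous_factor (hull_topology L) translate \<Omega>max \<beta> \<pi>max"
    and "statistical_coincidence_rel \<Lambda> L = equicontinuous_structure_rel L \<pi>max"
  shows "equicontinuous_structure_rel L \<pi>max = statistical_coincidence_rel \<Lambda> L \<and>
    proximal_rel L = statistical_coincidence_rel \<Lambda> L \<and>
    regional_proximal_rel L = statistical_coincidence_rel \<Lambda> L \<and>
    syndetic_proximal_rel L = statistical_coincidence_rel \<Lambda> L \<and>
    strong_proximal_rel L = statistical_coincidence_rel \<Lambda> L \<and>
    strong_regional_proximal_rel L = statistical_coincidence_rel \<Lambda> L \<and>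
    strong_syndetic_proximal_rel L = statistical_coincidence_rel \<Lambda> L \<and>
    (\<forall>\<xi>\<in>topspace \<Omega>max. coincidence_rank L \<pi>max \<xi> = 1)"
proof -
  let ?E = "equicontinuous_structure_rel L \<pi>max" and ?SC = "statistical_coincidence_rel \<Lambda> L"
  have fac: "factor_map (hull_topology L) translate \<Omega>max \<beta> \<pi>max" and eq: "equicontinuous_system \<Omega>max \<beta>"
    using assms(5) by (auto simp: maximal_equicontinuous_factor_def)
  interpret coincidence_relation L \<Lambda> ?E
  proof
    show "?E \<subseteq> delone_hull L \<times> delone_hull L"
      by (auto simp: equicontinuous_structure_rel_def)
    show "upper_density \<Lambda> ((x - y) \<union> (y - x)) = 0" if "(x, y) \<in> ?E" for x y
      using that unfolding assms(6)[symmetric] statistical_coincidence_rel_def by simp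
  qed (fact assms(1,2,4) equicontinuous_structure_rel_translate[OF fac]
    equicontinuous_structure_rel_limit[OF fac eq])+
  have "?E \<subseteq> strong_syndetic_proximal_rel L"
  proof (rule subrelI)
    fix x y assume "(x, y) \<in> ?E"
    then show "(x, y) \<in> strong_syndetic_proximal_rel L"
      using hull strongly_syndetically_proximal by (auto simp: strong_syndetic_proximal_rel_def)
  qed
  moreover have "regional_proximal_rel L \<subseteq> ?E"
    by (rule regional_proximal_imp_equicontinuous_structure[OF assms(1,2) fac eq])
  moreover note strong_syndetic_imp_strong_proximal[of L] strong_syndetic_imp_syndetic_proximal[of L]
    syndetic_imp_proximal[of L] proximal_imp_regional_proximal[of L]
    strong_proximal_imp_strong_regional_proximal[of L] strong_regional_proximal_imp_regional_proximal[of L]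
  ultimately have rels: "proximal_rel L = ?E" "regional_proximal_rel L = ?E" "syndetic_proximal_rel L = ?E"
    "strong_proximal_rel L = ?E" "strong_regional_proximal_rel L = ?E" "strong_syndetic_proximal_rel L = ?E"
    by blast+
  have "coincidence_rank L \<pi>max \<xi> = 1" if \<xi>: "\<xi> \<in> topspace \<Omega>max" for \<xi>
  proof -
    have "\<xi> \<in> \<pi>max ` delone_hull L"
      using fac \<xi> by (simp add: factor_map_def)
    then obtain x where "x \<in> delone_hull L" "\<pi>max x = \<xi>" by blast
    with rels(1) show ?thesis by (rule coincidence_rank_eq_1)
  qed
  then show ?thesis
    unfolding rels assms(6) by blast
qed

end
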